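(* Let $\Omega\subset\mathbb{R}^N$ be a bounded open set with boundary $\Gamma$ and let $v^-$ and $v^+$ be the respective solutions of $$v_t-\mathcal{M}^{\pm}(\nabla^2v)=0\ \text{ in }\ \Omega\times(0,\infty),\quad v=0\ \text{ on }\ \Omega\times\{0\},\quad v=1\ \text{ on }\ \Gamma\times(0,\infty).$$ The following claims hold. (i) If $\Gamma=\partial\left(\mathbb{R}^N\setminus\overline{\Omega}\right)$, then for every $x\in\overline{\Omega}$ $$\lim_{t\to0^+}4t\log v^-(x,t)=-\frac{d_\Gamma(x)^2}{\lambda},\qquad \lim_{t\to0^+}4t\log v^+(x,t)=-\frac{d_\Gamma(x)^2}{\Lambda}.$$ (ii) If $\Omega$ is of class $C^{0,\omega}$, then as $t\to0^+$ $$4t\log v^-(x,t)+\frac{d_\Gamma(x)^2}{\lambda}=O\left(t\log\psi_\omega(t)\right),\qquad 4t\log v^+(x,t)+\frac{d_\Gamma(x)^2}{\Lambda}=O\left(t\log\psi_\omega(t)\right),$$ uniformly for $x$ in every compact subset of $\overline{\Omega}$.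
   Context: Let $N\ge2$ be an integer and let $0<\lambda\le\Lambda$ be real numbers. For a symmetric real $N\times N$ matrix $X$ with eigenvalues $\lambda_1,\dots,\lambda_N$ (counted with multiplicity), the Pucci extremal operators are $$\mathcal{M}^-(X)=\Lambda\sum_{\lambda_i<0}\lambda_i+\lambda\sum_{\lambda_i>0}\lambda_i,\qquad \mathcal{M}^+(X)=\lambda\sum_{\lambda_i<0}\lambda_i+\Lambda\sum_{\lambda_i>0}\lambda_i .$$ The signs correspond: $v^-$ solves the problem with $\mathcal{M}^-$ and $v^+$ the one with $\mathcal{M}^+$. Equations hold in the viscosity sense; $\nabla^2 v$ is the Hessian in the space variable. Solutions are continuous on $\left(\overline{\Omega}\times[0,\infty)\right)\setminus(\Gamma\times\{0\})$, attain the initial and boundary values pointwise, and take values in $[0,1]$. $d_\Gamma(x)$ is the Euclidean distance from $x$ to $\Gamma$. Class $C^{0,\omega}$: let $\omega:(0,\infty)\to(0,\infty)$ be a strictly increasing continuous function with $\omega(0^+)=0$ (set $\omega(0)=0$). $\Omega$ is of class $C^{0,\omega}$ if there is $r>0$ such that for every $x_0\in\Gamma$ there are a (rigid, Cartesian) coordinate system $(y',y_N)\in\mathbb{R}^{N-1}\times\mathbb{R}$ and a function $\zeta:\mathbb{R}^{N-1}\to\mathbb{R}$ such that: $B_r(x_0)\cap\Omega=\{(y',y_N)\in B_r(x_0): y_N<\zeta(y')\}$; $B_r(x_0)\cap\Gamma=\{(y',y_N)\in B_r(x_0): y_N=\zeta(y')\}$; and $|\zeta(y')-\zeta(z')|\le\omega(|y'-z'|)$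 for all $(y',\zeta(y')),(z',\zeta(z'))\in B_r(x_0)\cap\Gamma$. The function $\psi_\omega:[0,\infty)\to[0,\infty)$ is $\psi_\omega(\sigma)=\inf_{s\ge0}\sqrt{s^2+[\omega(s)-\sigma]^2}$. The notation $F(x,t)=O(G(t))$ as $t\to0^+$ uniformly on $K$ means that there are $C,t_0>0$ with $|F(x,t)|\le C|G(t)|$ for all $x\in K$ and $0<t<t_0$. *)

theory Defs
  imports "HOL-Analysis.Analysis" "HOL-Computational_Algebra.Polynomial"
begin

section \<open>Pucci extremal operators\<close>

definition char_polynomial :: "real^'n^'n \<Rightarrow> real poly" where
  "char_polynomial X = det (mat [:0, 1:] - map_matrix (\<lambda>c. [:c:]) X)"

text \<open>The multiset of real roots of the characteristic polynomial.  For symmetric matrices, the only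
  ones used below, it consists of all \<open>N\<close> eigenvalues, counted with multiplicity.\<close>

definition eigenvalues :: "real^'n^'n \<Rightarrow> real multiset" where
  "eigenvalues X = proots (char_polynomial X)"

definition pucci_minus :: "real \<Rightarrow> real \<Rightarrow> real^'n^'n \<Rightarrow> real" where
  "pucci_minus lam \<Lambda> X =
     \<Lambda> * sum_mset {#e \<in># eigenvalues X. e < 0#} + lam * sum_mset {#e \<in># eigenvalues X. e > 0#}"

definition pucci_plus :: "real \<Rightarrow> real \<Rightarrow> real^'n^'n \<Rightarrow> real" where
  "pucci_plus lam \<Lambda> X =
     lam * sum_mset {#e \<in># eigenvalues X. e < 0#} + \<Lambda> * sum_mset {#e \<in># eigenvalues X. e > 0#}"


section \<open>Viscosity solutions of the initial-boundary value problem\<close>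

text \<open>Test functions of class \<open>C\<^sup>2\<close> in space and \<open>C\<^sup>1\<close> in time on \<open>U\<close>: \<open>\<phi>t\<close> is the time derivative,
  \<open>g\<close> the spatial gradient and \<open>H\<close> the spatial Hessian of \<open>\<phi>\<close>.  Continuity of \<open>H\<close> makes
  \<open>H\<close> symmetric on open \<open>U\<close>.\<close>

definition C21_on ::
  "((real^'n) \<times> real) set \<Rightarrow> ((real^'n) \<times> real \<Rightarrow> real) \<Rightarrow> ((real^'n) \<times> real \<Rightarrow> real)
    \<Rightarrow> ((real^'n) \<times> real \<Rightarrow> real^'n) \<Rightarrow> ((real^'n) \<times> real \<Rightarrow> real^'n^'n) \<Rightarrow> bool" where
  "C21_on U \<phi> \<phi>t g H \<longleftrightarrow>
     continuous_on U \<phi> \<and> continuous_on U \<phi>t \<and> continuous_on U g \<and> continuous_on U H \<and>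
     (\<forall>(x, t) \<in> U.
        ((\<lambda>s. \<phi> (x, s)) has_real_derivative \<phi>t (x, t)) (at t) \<and>
        ((\<lambda>y. \<phi> (y, t)) has_derivative (\<lambda>h. g (x, t) \<bullet> h)) (at x) \<and>
        ((\<lambda>y. g (y, t)) has_derivative (\<lambda>h. H (x, t) *v h)) (at x))"

text \<open>Since \<open>U\<close> is an arbitrary open neighbourhood of \<open>z\<close>, a maximum (minimum) over \<open>U\<close> of \<open>v - \<phi>\<close>
  is a local maximum (minimum).\<close>

definition viscosity_subsolution ::
  "(real^'n^'n \<Rightarrow> real) \<Rightarrow> ((real^'n) \<times> real) set \<Rightarrow> ((real^'n) \<times> real \<Rightarrow> real) \<Rightarrow> bool" where
  "viscosity_subsolution F Q v \<longleftrightarrow>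
     (\<forall>z U \<phi> \<phi>t g H. open U \<and> U \<subseteq> Q \<and> z \<in> U \<and> C21_on U \<phi> \<phi>t g H \<and>
        (\<forall>w\<in>U. v w - \<phi> w \<le> v z - \<phi> z) \<longrightarrow> \<phi>t z - F (H z) \<le> 0)"

definition viscosity_supersolution ::
  "(real^'n^'n \<Rightarrow> real) \<Rightarrow> ((real^'n) \<times> real) set \<Rightarrow> ((real^'n) \<times> real \<Rightarrow> real) \<Rightarrow> bool" where
  "viscosity_supersolution F Q v \<longleftrightarrow>
     (\<forall>z U \<phi> \<phi>t g H. open U \<and> U \<subseteq> Q \<and> z \<in> U \<and> C21_on U \<phi> \<phi>t g H \<and>
        (\<forall>w\<in>U. v z - \<phi> z \<le> v w - \<phi> w) \<longrightarrow> \<phi>t z - F (H z) \<ge> 0)"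

text \<open>\<open>v\<^sub>t - F(\<nabla>\<^sup>2 v) = 0\<close> in \<open>\<Omega> \<times> (0,\<infinity>)\<close>, \<open>v = 0\<close> on \<open>\<Omega> \<times> {0}\<close>, \<open>v = 1\<close> on \<open>\<Gamma> \<times> (0,\<infinity>)\<close>.\<close>

definition is_solution ::
  "(real^'n^'n \<Rightarrow> real) \<Rightarrow> (real^'n) set \<Rightarrow> ((real^'n) \<times> real \<Rightarrow> real) \<Rightarrow> bool" where
  "is_solution F \<Omega> v \<longleftrightarrow>
     (let D = closure \<Omega> \<times> {0..} - frontier \<Omega> \<times> {0} in
       continuous_on D v \<and> (\<forall>z\<in>D. 0 \<le> v z \<and> v z \<le> 1)) \<and>
     viscosity_subsolution F (\<Omega> \<times> {0<..}) v \<and>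
     viscosity_supersolution F (\<Omega> \<times> {0<..}) v \<and>
     (\<forall>x\<in>\<Omega>. v (x, 0) = 0) \<and>
     (\<forall>x\<in>frontier \<Omega>. \<forall>t>0. v (x, t) = 1)"


section \<open>Domains of class \<open>C\<^sup>0\<^sup>,\<^sup>\<omega>\<close>\<close>

definition modulus :: "(real \<Rightarrow> real) \<Rightarrow> bool" where
  "modulus \<omega> \<longleftrightarrow> (\<forall>s>0. \<omega> s > 0) \<and> strict_mono_on {0<..} \<omega> \<and> continuous_on {0<..} \<omega> \<and>
     (\<omega> \<longlongrightarrow> 0) (at_right 0) \<and> \<omega> 0 = 0"

text \<open>A Cartesian coordinate system of \<open>\<real>\<^sup>N\<close> is a map \<open>y \<mapsto> A (y - p)\<close> with \<open>A\<close> orthogonal.  One index \<open>k\<close>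
  plays the role of the last coordinate \<open>y\<^sub>N\<close>; the remaining coordinates \<open>y'\<close> in \<open>\<real>\<^sup>N\<^sup>-\<^sup>1\<close> are
  represented by the vector whose \<open>k\<close>-th component is set to \<open>0\<close>, which preserves \<open>\<bar>y' - z'\<bar>\<close>.
  Only the values of \<open>\<zeta>\<close> on such vectors matter.\<close>

definition coord :: "real^'n^'n \<Rightarrow> real^'n \<Rightarrow> real^'n \<Rightarrow> real^'n" where
  "coord A p y = A *v (y - p)"

definition horiz :: "'n \<Rightarrow> real^'n \<Rightarrow> real^'n" where
  "horiz k y = (\<chi> i. if i = k then 0 else y $ i)"

definition class_C0 :: "(real \<Rightarrow> real) \<Rightarrow> (real^'n) set \<Rightarrow> bool" where
  "class_C0 \<omega> \<Omega> \<longleftrightarrow>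
     (\<exists>r>0. \<forall>x0\<in>frontier \<Omega>. \<exists>A p k. \<exists>\<zeta> :: real^'n \<Rightarrow> real.
        orthogonal_matrix A \<and>
        ball x0 r \<inter> \<Omega> =
          {y \<in> ball x0 r. coord A p y $ k < \<zeta> (horiz k (coord A p y))} \<and>
        ball x0 r \<inter> frontier \<Omega> =
          {y \<in> ball x0 r. coord A p y $ k = \<zeta> (horiz k (coord A p y))} \<and>
        (\<forall>y \<in> ball x0 r \<inter> frontier \<Omega>. \<forall>z \<in> ball x0 r \<inter> frontier \<Omega>.
           \<bar>\<zeta> (horiz k (coord A p y)) - \<zeta> (horiz k (coord A p z))\<bar>
             \<le> \<omega> (norm (horiz k (coord A p y) - horiz k (coord A p z)))))"

definition psi :: "(real \<Rightarrow> real) \<Rightarrow> real \<Rightarrow> real" where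
  "psi \<omega> \<sigma> = (INF s\<in>{0..}. sqrt (s\<^sup>2 + (\<omega> s - \<sigma>)\<^sup>2))"


section \<open>Uniform asymptotics\<close>

definition uniform_bigo :: "'a set \<Rightarrow> ('a \<Rightarrow> real \<Rightarrow> real) \<Rightarrow> (real \<Rightarrow> real) \<Rightarrow> bool" where
  "uniform_bigo K F G \<longleftrightarrow>
     (\<exists>C>0. \<exists>t0>0. \<forall>x\<in>K. \<forall>t. 0 < t \<and> t < t0 \<longrightarrow> \<bar>F x t\<bar> \<le> C * \<bar>G t\<bar>)"

end

theory Submission
  imports Defs "HOL-Real_Asymp.Real_Asymp"
begin

text \<open>
  For radial functions both Pucci operators reduce to explicit expressions, so \<open>v\<close> can be compared
  with smooth radial barriers; no doubling of variables is needed.  Write \<open>\<mu> = \<lambda>\<close> for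
  \<open>\<M>\<^sup>-\<close> and \<open>\<mu> = \<Lambda>\<close> for \<open>\<M>\<^sup>+\<close>, and \<open>d = d\<^sub>\<Gamma>(x)\<close>.

  Upper bound: on a ball of radius \<open>R < d\<close> around \<open>x\<close> the convex function
  \<open>exp (\<mu> \<kappa>\<^sup>2 t) h(\<kappa> |y - x|) / h(\<kappa> R)\<close> with \<open>\<Delta>h \<le> h\<close> and \<open>h(r)\<close> of the order of
  \<open>exp r\<close> up to powers of \<open>r\<close> is a supersolution.  Letting \<open>R \<rightarrow> d\<close> and choosing
  \<open>\<kappa> = d / (2 \<mu> t)\<close> gives \<open>exp (- d\<^sup>2 / (4 \<mu> t))\<close> times a power of \<open>1/t\<close>.

  Lower bound: if \<open>\<Omega>\<close> avoids the ball of radius \<open>\<rho>\<close> around \<open>p\<close>, then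
  \<open>t powr (- k) * exp (- |y - p|\<^sup>2 / (4 \<mu> t))\<close> with \<open>k = N \<Lambda> / (2 \<mu>)\<close> is a subsolution, and
  its maximum over \<open>|y - p| \<ge> \<rho>\<close>, \<open>t > 0\<close> is a power of \<open>\<rho>\<close> up to a constant.
  For (i) take exterior points \<open>p\<close> tending to a boundary point nearest to \<open>x\<close>.  For (ii) move
  from that point by \<open>t\<close> along the axis of the chart; by the definition of \<open>\<psi>\<^sub>\<omega>\<close> the point
  reached has distance at least \<open>\<psi>\<^sub>\<omega>(t)\<close> from \<open>\<Omega>\<close>.
\<close>

section \<open>Pucci operators on Hessians of radial functions\<close>

text \<open>This is a I + b y y^T, the shape of the Hessian of f(|y - p|^2), where a = 2 f', b = 4
  f'' and y - p stands in place of y.\<close>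

definition outer_pert :: "real \<Rightarrow> real \<Rightarrow> real^'n \<Rightarrow> real^'n^'n" where
  "outer_pert a b y = (\<chi> i j. (if i = j then a else 0) + b * y $ i * y $ j)"

lemma outer_pert_mult_vec: "outer_pert a b y *v h = a *\<^sub>R h + (b * (y \<bullet> h)) *\<^sub>R y"
proof -
  have "(\<Sum>j\<in>UNIV. ((if i = j then a else 0) + b * y $ i * y $ j) * h $ j)
      = a * h $ i + b * (\<Sum>j\<in>UNIV. y $ j * h $ j) * y $ i" for i
  proof -
    have "((if i = j then a else 0) + b * y $ i * y $ j) * h $ j
        = (if i = j then a * h $ j else 0) + (b * y $ i) * (y $ j * h $ j)" for j
      by (simp add: algebra_simps)
    then have "(\<Sum>j\<in>UNIV. ((if i = j then a else 0) + b * y $ i * y $ j) * h $ j)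
      = (\<Sum>j\<in>UNIV. if i = j then a * h $ j else 0) + (b * y $ i) * (\<Sum>j\<in>UNIV. y $ j * h $ j)"
      by (simp only: sum.distrib sum_distrib_left)
    then show ?thesis
      by simp
  qed
  then show ?thesis
    by (simp add: vec_eq_iff outer_pert_def matrix_vector_mult_def inner_vec_def)
qed

section \<open>Similarity and diagonalization of the radial Hessians\<close>

lemma map_matrix_const_poly_mult:
  "map_matrix (\<lambda>c. [:c:]) (A ** B) = map_matrix (\<lambda>c. [:c:]) A ** map_matrix (\<lambda>c. [:c:]) (B :: real^'n^'n)"
proof -
  have "[:sum f S:] = (\<Sum>k\<in>S. [:f k:])" for f :: "'n \<Rightarrow> real" and S
  proof (induction S rule: infinite_finite_induct)
    case (insert x F)
    then show ?case by (simp add: insert.IH[symmetric])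
  qed auto
  then show ?thesis
    by (simp add: vec_eq_iff matrix_matrix_mult_def mult.commute)
qed

text \<open>The scalar matrix X I commutes with constant matrices, so M Q = Q D lifts to (X I - M) Q
  = Q (X I - D). Take determinants and cancel det Q, which is nonzero because its product with det R
  is 1.\<close>

lemma char_polynomial_similar:
  fixes M D Q R :: "real^'n^'n"
  assumes "M ** Q = Q ** D" "Q ** R = mat 1"
  shows "char_polynomial M = char_polynomial D"
proof -
  let ?C = "map_matrix (\<lambda>c::real. [:c:]) :: real^'n^'n \<Rightarrow> real poly^'n^'n"
  have comm: "(mat [:0,1:] :: real poly^'n^'n) ** ?C Q = ?C Q ** mat [:0,1:]"
    by (simp add: vec_eq_iff matrix_matrix_mult_def mat_def if_distrib if_distribR cong: if_cong)
  have "?C (mat 1) = mat 1"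
    by (simp add: vec_eq_iff mat_def one_pCons)
  then have "det (?C Q) * det (?C R) = 1"
    by (metis assms(2) det_I det_mul map_matrix_const_poly_mult)
  then have nz: "det (?C Q) \<noteq> 0" by auto
  have "(mat [:0,1:] - ?C M) ** ?C Q = ?C Q ** (mat [:0,1:] - ?C D)"
  proof -
    have "(A - B) ** E = A ** E - B ** E" "E ** (A - B) = E ** A - E ** B" for A B E :: "real poly^'n^'n"
      by (simp_all add: vec_eq_iff matrix_matrix_mult_def left_diff_distrib right_diff_distrib sum_subtractf)
    then show ?thesis
      using comm assms(1) by (simp flip: map_matrix_const_poly_mult)
  qed
  then have "char_polynomial M * det (?C Q) = det (?C Q) * char_polynomial D"
    unfolding char_polynomial_def by (metis det_mul)
  then show ?thesis using nz by simp
qed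

lemma eigenvalues_diagonal:
  fixes d :: "'n::finite \<Rightarrow> real"
  shows "eigenvalues (\<chi> i j. if i = j then d i else 0) = image_mset d (mset_set UNIV)"
proof -
  have "char_polynomial (\<chi> i j. if i = j then d i else 0) = (\<Prod>i\<in>UNIV. [:- d i, 1:])"
    unfolding char_polynomial_def by (subst det_diagonal) (auto simp: mat_def)
  moreover have "(\<Sum>x\<in>S. {#d x#}) = image_mset d (mset_set S)" for S
    by (induction S rule: infinite_finite_induct) auto
  ultimately show ?thesis
    by (simp add: eigenvalues_def proots_prod)
qed

lemma diagonal_mult_axis:
  fixes d :: "'n::finite \<Rightarrow> real"
  shows "(\<chi> i j. if i = j then d i else 0) *v axis k 1 = d k *\<^sub>R axis k 1"
  unfolding matrix_vector_mult_basis by (simp add: vec_eq_iff column_def axis_def)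

text \<open>\<open>y\<close> is an eigenvector for a + b |y|^2, and every vector orthogonal to
  \<open>y\<close> is one for a. \<open>Q\<close> is an orthogonal matrix that takes one axis to the
  direction of \<open>y\<close>.\<close>

lemma outer_pert_diagonalize:
  fixes y :: "real^'n"
  obtains Q and k :: 'n where "orthogonal_matrix Q"
    "outer_pert a b y ** Q = Q ** (\<chi> i j. if i = j then a + (if i = k then b * (norm y)\<^sup>2 else 0) else 0)"
proof -
  fix k0 :: 'n
  \<comment> \<open>For \<open>y = 0\<close> the rank-one term vanishes and any unit vector
    serves.\<close>
  define e where "e = (if y = 0 then axis k0 1 else (1 / norm y) *\<^sub>R y)"
  have "norm e = 1" by (simp add: e_def)
  then obtain Q :: "real^'n^'n" and k where Q: "orthogonal_matrix Q" "Q *v (axis k 1) = e"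
    using orthogonal_matrix_exists_basis by metis
  have y: "y = norm y *\<^sub>R e" by (simp add: e_def)
  let ?D = "\<chi> i j. if i = j then a + (if i = k then b * (norm y)\<^sup>2 else 0) else 0"
  have "(outer_pert a b y ** Q) *v axis j 1 = (Q ** ?D) *v axis j 1" for j
  proof -
    have D: "?D *v axis j 1 = (a + (if j = k then b * (norm y)\<^sup>2 else 0)) *\<^sub>R axis j 1"
      by (rule diagonal_mult_axis)
    \<comment> \<open>\<open>Q\<close> preserves inner products, so its columns other than the
      \<open>k\<close>-th are orthogonal to \<open>y\<close>.\<close>
    have "e \<bullet> (Q *v axis j 1) = axis k 1 \<bullet> (axis j 1 :: real^'n)"
      using Q by (metis dot_lmul_matrix matrix_vector_mul_assoc matrix_vector_mul_lid orthogonal_matrix_def transpose_matrix_vector vector_transpose_matrix)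
    then have ye: "y \<bullet> (Q *v axis j 1) = norm y * (if j = k then 1 else 0)"
      by (subst y) (auto simp: inner_axis_axis)
    have "(outer_pert a b y ** Q) *v axis j 1 = a *\<^sub>R (Q *v axis j 1) + (b * (y \<bullet> (Q *v axis j 1))) *\<^sub>R y"
      by (simp add: outer_pert_mult_vec flip: matrix_vector_mul_assoc)
    also have "\<dots> = (a + (if j = k then b * (norm y)\<^sup>2 else 0)) *\<^sub>R (Q *v axis j 1)"
    proof (cases "j = k")
      case True
      have "(b * norm y) *\<^sub>R y = (b * (norm y)\<^sup>2) *\<^sub>R e"
        by (subst (2) y) (simp add: power2_eq_square mult.assoc)
      with True ye Q(2) show ?thesis by (simp add: scaleR_add_left)
    next
      case False
      with ye show ?thesis by simp
    qed
    also have "\<dots> = (Q ** ?D) *v axis j 1"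
      by (simp add: D matrix_vector_mult_scaleR flip: matrix_vector_mul_assoc)
    finally show ?thesis .
  qed
  then have "outer_pert a b y ** Q = Q ** ?D"
    by (simp add: vec_eq_iff matrix_vector_mult_basis column_def)
  then show thesis using that Q(1) by blast
qed

lemma eigenvalues_outer_pert:
  fixes y :: "real^'n"
  obtains k :: 'n where
    "eigenvalues (outer_pert a b y) =
       image_mset (\<lambda>i. a + (if i = k then b * (norm y)\<^sup>2 else 0)) (mset_set UNIV)"
proof -
  obtain Q k where "orthogonal_matrix Q"
    and *: "outer_pert a b y ** Q = Q ** (\<chi> i j. if i = j then a + (if i = k then b * (norm y)\<^sup>2 else 0) else 0)"
    by (rule outer_pert_diagonalize)
  then have "Q ** transpose Q = mat 1" by (simp add: orthogonal_matrix_def)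
  from char_polynomial_similar[OF * this]
  have "eigenvalues (outer_pert a b y) = eigenvalues (\<chi> i j. if i = j then a + (if i = k then b * (norm y)\<^sup>2 else 0) else 0)"
    by (simp add: eigenvalues_def)
  then show thesis
    using that[of k] by (simp only: eigenvalues_diagonal)
qed

text \<open>Zero eigenvalues are dropped by both filters; in the indexed sum they fall into the
  second branch and contribute 0.\<close>

lemma weighted_sum_eigenvalues:
  fixes d :: "'n::finite \<Rightarrow> real" and X :: "real^'n^'n"
  assumes "eigenvalues X = image_mset d (mset_set UNIV)"
  shows "c1 * sum_mset {#e \<in># eigenvalues X. e < 0#} + c2 * sum_mset {#e \<in># eigenvalues X. e > 0#}
       = (\<Sum>i\<in>UNIV. if d i < 0 then c1 * d i else c2 * d i)"
proof -
  have "sum_mset {#e \<in># image_mset d (mset_set S). P e#} = (\<Sum>i\<in>S. if P (d i) then d i else 0)" for S P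
    by (induction S rule: infinite_finite_induct) auto
  then show ?thesis
    by (auto simp: assms sum_distrib_left sum.distrib[symmetric] intro!: sum.cong)
qed

text \<open>Holds for \<open>F = \<M>\<^sup>-\<close> with \<open>\<mu> = \<lambda>\<close> and for \<open>F = \<M>\<^sup>+\<close> with \<open>\<mu> = \<Lambda>\<close>, which allows
  both operators to be treated at once.\<close>

definition radial_bounds :: "(real^'n^'n \<Rightarrow> real) \<Rightarrow> real \<Rightarrow> real \<Rightarrow> bool" where
  "radial_bounds F \<mu> \<Lambda> \<longleftrightarrow> 0 < \<mu> \<and> 0 < \<Lambda> \<and>
     (\<forall>a b y. 0 \<le> a \<and> 0 \<le> b \<longrightarrow> F (outer_pert a b y) \<le> \<mu> * (real CARD('n) * a + b * (norm y)\<^sup>2)) \<and>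
     (\<forall>a b y. a \<le> 0 \<and> 0 \<le> b \<longrightarrow> real CARD('n) * \<Lambda> * a + \<mu> * b * (norm y)\<^sup>2 \<le> F (outer_pert a b y))"

text \<open>All eigenvalues are \<open>a\<close> except one, which is a + b |y|^2. In the upper
  bound none is negative, so only the weight \<open>c2\<close> occurs. The lower bound is proved
  eigenvalue by eigenvalue.\<close>

lemma radial_boundsI:
  fixes F :: "real^'n^'n \<Rightarrow> real"
  assumes F: "\<And>X. F X = c1 * sum_mset {#e \<in># eigenvalues X. e < 0#} + c2 * sum_mset {#e \<in># eigenvalues X. e > 0#}"
    and c: "0 < c1" "0 < c2" "c1 \<le> \<Lambda>" "c2 \<le> \<Lambda>" "c1 = \<Lambda> \<or> c2 = \<Lambda>"
  shows "radial_bounds F c2 \<Lambda>"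
  unfolding radial_bounds_def
proof (intro conjI allI impI)
  show "0 < c2" "0 < \<Lambda>" using c by auto
  fix a b :: real and y :: "real^'n"
  obtain k :: 'n where e: "eigenvalues (outer_pert a b y) =
       image_mset (\<lambda>i. a + (if i = k then b * (norm y)\<^sup>2 else 0)) (mset_set UNIV)"
    by (rule eigenvalues_outer_pert[of a b y])
  define g where "g i = b * (norm y)\<^sup>2 * (if i = k then 1 else 0)" for i
  have e: "eigenvalues (outer_pert a b y) = image_mset (\<lambda>i. a + g i) (mset_set UNIV)"
    unfolding e g_def by (intro image_mset_cong) auto
  have val: "F (outer_pert a b y) = (\<Sum>i\<in>UNIV. if a + g i < 0 then c1 * (a + g i) else c2 * (a + g i))"
    unfolding F by (rule weighted_sum_eigenvalues[OF e])
  have sum_g: "(\<Sum>i\<in>UNIV. c * a + c2 * g i) = real CARD('n) * c * a + c2 * b * (norm y)\<^sup>2" for c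
    unfolding g_def by (simp add: sum.distrib sum_distrib_left[symmetric])
  {
    assume "0 \<le> a \<and> 0 \<le> b"
    then have "\<not> a + g i < 0" for i by (simp add: g_def not_less)
    then have "F (outer_pert a b y) = (\<Sum>i\<in>UNIV. c2 * a + c2 * g i)"
      unfolding val by (simp add: distrib_left)
    then show "F (outer_pert a b y) \<le> c2 * (real CARD('n) * a + b * (norm y)\<^sup>2)"
      by (simp only: sum_g) (simp add: algebra_simps)
  next
    assume ab: "a \<le> 0 \<and> 0 \<le> b"
    \<comment> \<open>The part \<open>a \<le> 0\<close> is charged with the largest weight and the
      excess \<open>g i \<ge> 0\<close> is credited with \<open>c2\<close>. For a negative
      eigenvalue, \<open>c1 = \<Lambda>\<close> leaves
      \<open>c2 * g i \<le> \<Lambda> * g i\<close>, while \<open>c2 = \<Lambda>\<close> leaves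
      \<open>\<Lambda> * (a + g i) \<le> c1 * (a + g i)\<close>.\<close>
    have "\<Lambda> * a + c2 * g i \<le> (if a + g i < 0 then c1 * (a + g i) else c2 * (a + g i))" for i
    proof -
      have g: "0 \<le> g i" using ab by (simp add: g_def)
      have 1: "\<Lambda> * a \<le> c1 * a" "\<Lambda> * a \<le> c2 * a" using c ab by (auto intro: mult_right_mono_neg)
      show ?thesis
      proof (cases "a + g i < 0")
        case False
        then show ?thesis using 1 by (simp add: distrib_left)
      next
        case True
        from c(5) show ?thesis
        proof
          assume "c1 = \<Lambda>"
          then show ?thesis using True g c mult_right_mono[of c2 \<Lambda> "g i"] by (simp add: distrib_left)
        next
          assume "c2 = \<Lambda>"
          then show ?thesis using True c mult_right_mono_neg[of c1 \<Lambda> "a + g i"] by (simp add: distrib_left)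
        qed
      qed
    qed
    then show "real CARD('n) * \<Lambda> * a + c2 * b * (norm y)\<^sup>2 \<le> F (outer_pert a b y)"
      unfolding val sum_g[symmetric] by (intro sum_mono) auto
  }
qed

lemma radial_bounds_pucci:
  assumes "0 < lam" "lam \<le> \<Lambda>"
  shows "radial_bounds (pucci_minus lam \<Lambda>) lam \<Lambda>" "radial_bounds (pucci_plus lam \<Lambda>) \<Lambda> \<Lambda>"
  using radial_boundsI[of "pucci_minus lam \<Lambda>", OF pucci_minus_def]
    radial_boundsI[of "pucci_plus lam \<Lambda>", OF pucci_plus_def] assms by auto

section \<open>Comparison with smooth barriers\<close>

lemma C21_on_subset:
  assumes "C21_on V \<phi> \<phi>t g H" "U \<subseteq> V"
  shows "C21_on U \<phi> \<phi>t g H"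
  using assms unfolding C21_on_def by (fastforce intro: continuous_on_subset)

text \<open>Chain rule through q = |y - p|^2. Taking the profile in the squared distance keeps the
  function smooth at the centre \<open>p\<close>.\<close>

lemma C21_on_radial:
  fixes p :: "real^'n" and f fs fq fqq :: "real \<Rightarrow> real \<Rightarrow> real"
  assumes cont: "continuous_on (UNIV \<times> I) (\<lambda>(q, s). f q s)" "continuous_on (UNIV \<times> I) (\<lambda>(q, s). fs q s)"
      "continuous_on (UNIV \<times> I) (\<lambda>(q, s). fq q s)" "continuous_on (UNIV \<times> I) (\<lambda>(q, s). fqq q s)"
    and ds: "\<And>q s. s \<in> I \<Longrightarrow> ((\<lambda>s. f q s) has_real_derivative fs q s) (at s)"
    and dq: "\<And>q s. s \<in> I \<Longrightarrow> ((\<lambda>q. f q s) has_real_derivative fq q s) (at q)"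
    and dqq: "\<And>q s. s \<in> I \<Longrightarrow> ((\<lambda>q. fq q s) has_real_derivative fqq q s) (at q)"
  shows "C21_on (UNIV \<times> I)
    (\<lambda>(y, s). f ((norm (y - p))\<^sup>2) s)
    (\<lambda>(y, s). fs ((norm (y - p))\<^sup>2) s)
    (\<lambda>(y, s). (2 * fq ((norm (y - p))\<^sup>2) s) *\<^sub>R (y - p))
    (\<lambda>(y, s). outer_pert (2 * fq ((norm (y - p))\<^sup>2) s) (4 * fqq ((norm (y - p))\<^sup>2) s) (y - p))"
proof -
  have comp: "continuous_on (UNIV \<times> I) (\<lambda>(y, s). h ((norm (y - p))\<^sup>2) s)"
    if "continuous_on (UNIV \<times> I) (\<lambda>(q, s). h q s)" for h :: "real \<Rightarrow> real \<Rightarrow> real"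
  proof -
    have "continuous_on (UNIV \<times> I) (\<lambda>z. (\<lambda>(q, s). h q s) ((norm (fst z - p))\<^sup>2, snd z))"
      by (rule continuous_on_compose2[OF that]) (auto intro!: continuous_intros)
    then show ?thesis by (simp add: case_prod_beta')
  qed
  have norm_deriv: "((\<lambda>y. (norm (y - p))\<^sup>2) has_derivative (\<lambda>h. 2 * ((y - p) \<bullet> h))) (at y)" for y
    unfolding power2_norm_eq_inner
    by (auto intro!: derivative_eq_intros simp: inner_commute)
  have grad: "((\<lambda>y. f ((norm (y - p))\<^sup>2) s) has_derivative
      (\<lambda>h. ((2 * fq ((norm (y - p))\<^sup>2) s) *\<^sub>R (y - p)) \<bullet> h)) (at y)" if "s \<in> I" for y s
    by (rule has_derivative_eq_rhs[OF has_derivative_compose[OF norm_deriv dq[OF that, unfolded has_field_derivative_def]]])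
       (simp add: fun_eq_iff)
  have hess: "((\<lambda>y. (2 * fq ((norm (y - p))\<^sup>2) s) *\<^sub>R (y - p)) has_derivative
      (\<lambda>h. outer_pert (2 * fq ((norm (y - p))\<^sup>2) s) (4 * fqq ((norm (y - p))\<^sup>2) s) (y - p) *v h)) (at y)"
    if "s \<in> I" for y s
    by (rule has_derivative_eq_rhs[OF has_derivative_scaleR[OF has_derivative_mult_right[OF
          has_derivative_compose[OF norm_deriv dqq[OF that, unfolded has_field_derivative_def]]]
          has_derivative_diff[OF has_derivative_ident has_derivative_const]]])
       (simp add: fun_eq_iff outer_pert_mult_vec algebra_simps)
  have cont_outer: "continuous_on (UNIV \<times> I) (\<lambda>z. outer_pert (2 * fq ((norm (fst z - p))\<^sup>2) (snd z))
       (4 * fqq ((norm (fst z - p))\<^sup>2) (snd z)) (fst z - p))"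
    using comp[OF cont(3)] comp[OF cont(4)] unfolding outer_pert_def case_prod_beta'
    by (intro continuous_on_vec_lambda continuous_intros; rename_tac i j; case_tac "i = j")
       (simp_all add: continuous_intros)
  have "continuous_on (UNIV \<times> I) (\<lambda>(y, s). (2 * fq ((norm (y - p))\<^sup>2) s) *\<^sub>R (y - p))"
    using comp[OF cont(3)] by (auto simp: case_prod_beta' intro!: continuous_intros)
  with comp[OF cont(1)] comp[OF cont(2)] cont_outer show ?thesis
    unfolding C21_on_def case_prod_beta'
    by (intro conjI ballI) (auto intro: ds grad hess)
qed

text \<open>The compactness part of both comparison proofs: a function that is positive somewhere,
  but not near the two ends of the time interval nor on the lateral boundary, attains its maximum
  inside the open cylinder.\<close>

lemma interior_maximum:
  fixes B :: "(real^'n) set" and \<Psi> :: "(real^'n) \<times> real \<Rightarrow> real"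
  assumes B: "open B" "bounded B" and T: "0 < T"
    and cont: "continuous_on (closure B \<times> {0<..<T}) \<Psi>"
    and s1: "0 < s1" "\<And>y s. y \<in> closure B \<Longrightarrow> 0 < s \<Longrightarrow> s < T \<Longrightarrow> s < s1 \<or> T - s1 < s \<Longrightarrow> \<Psi> (y, s) \<le> 0"
    and lateral: "\<And>y s. y \<in> frontier B \<Longrightarrow> 0 < s \<Longrightarrow> s < T \<Longrightarrow> \<Psi> (y, s) \<le> 0"
    and pos: "y0 \<in> B" "0 < t0" "t0 < T" "\<Psi> (y0, t0) > 0"
  obtains y s where "y \<in> B" "0 < s" "s < T" "\<And>w. w \<in> B \<times> {0<..<T} \<Longrightarrow> \<Psi> w \<le> \<Psi> (y, s)"
proof -
  \<comment> \<open>With \<open>r < s1\<close> every point where \<open>\<Psi>\<close> is positive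
    lies in the compact cylinder \<open>?C\<close>, and \<open>0 < r\<close> keeps \<open>?C\<close>
    inside the region where \<open>\<Psi>\<close> is continuous.\<close>
  define r where "r = min s1 (T / 2) / 2"
  have r: "0 < r" "r < s1" "r < T / 2" using s1 T by (auto simp: r_def min_def)
  let ?C = "closure B \<times> {r..T - r}"
  have "compact ?C" using B by (intro compact_Times) (auto simp: compact_eq_bounded_closed)
  have in_C: "z \<in> ?C" if "z \<in> B \<times> {0<..<T}" "\<Psi> z > 0" for z
  proof -
    obtain y s where zz: "z = (y, s)" by (cases z)
    then have "y \<in> closure B" "0 < s" "s < T" using that closure_subset[of B] by auto
    with that s1(2)[of y s] r have "s1 \<le> s" "s \<le> T - s1" unfolding zz by linarith+
    then show ?thesis using \<open>y \<in> closure B\<close> r by (auto simp: zz)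
  qed
  have "(y0, t0) \<in> ?C" using in_C pos by auto
  moreover have "continuous_on ?C \<Psi>"
    using r by (intro continuous_on_subset[OF cont]) auto
  ultimately obtain z where z: "z \<in> ?C" "\<And>w. w \<in> ?C \<Longrightarrow> \<Psi> w \<le> \<Psi> z"
    using continuous_attains_sup[OF \<open>compact ?C\<close>] by blast
  obtain y s where zz: "z = (y, s)" by (cases z)
  have "\<Psi> z > 0" using z(2)[OF \<open>(y0, t0) \<in> ?C\<close>] pos by simp
  with lateral[of y s] z(1) r have "y \<in> B"
    using B(1) by (force simp: zz frontier_def interior_open)
  moreover have "\<Psi> w \<le> \<Psi> z" if "w \<in> B \<times> {0<..<T}" for w
    using in_C[OF that] z(2)[of w] \<open>\<Psi> z > 0\<close> by (cases "\<Psi> w > 0") auto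
  ultimately show thesis using that[of y s] z(1) r by (auto simp: zz)
qed

text \<open>This adds the penalty \<eta>/(T - s) to a barrier; the gradient and Hessian are
  unaffected.\<close>

lemma C21_on_add_time:
  assumes "C21_on U \<phi> \<phi>t g H" "U \<subseteq> UNIV \<times> I"
    and c: "\<And>s. s \<in> I \<Longrightarrow> (c has_real_derivative c' s) (at s)" "continuous_on I c'"
  shows "C21_on U (\<lambda>z. \<phi> z + c (snd z)) (\<lambda>z. \<phi>t z + c' (snd z)) g H"
proof -
  have "continuous_on I c"
    using c(1) by (meson DERIV_isCont continuous_at_imp_continuous_on)
  moreover have "continuous_on U (\<lambda>z. h (snd z))" if "continuous_on I h" for h :: "real \<Rightarrow> real"
    by (rule continuous_on_compose2[OF that continuous_on_snd[OF continuous_on_id]]) (use assms(2) in auto)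
  ultimately have "continuous_on U (\<lambda>z. c (snd z))" "continuous_on U (\<lambda>z. c' (snd z))"
    using c(2) by blast+
  moreover have "((\<lambda>s. \<phi> (x, s) + c s) has_real_derivative \<phi>t (x, s) + c' s) (at s)"
      "((\<lambda>y. \<phi> (y, s) + c s) has_derivative (\<lambda>h. g (x, s) \<bullet> h)) (at x)"
      "((\<lambda>y. g (y, s)) has_derivative (\<lambda>h. H (x, s) *v h)) (at x)"
    if "(x, s) \<in> U" for x s
  proof -
    have "s \<in> I" using that assms(2) by auto
    have d: "((\<lambda>s. \<phi> (x, s)) has_real_derivative \<phi>t (x, s)) (at s)"
      "((\<lambda>y. \<phi> (y, s)) has_derivative (\<lambda>h. g (x, s) \<bullet> h)) (at x)"
      "((\<lambda>y. g (y, s)) has_derivative (\<lambda>h. H (x, s) *v h)) (at x)"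
      using assms(1)[unfolded C21_on_def] that by simp_all blast+
    show "((\<lambda>s. \<phi> (x, s) + c s) has_real_derivative \<phi>t (x, s) + c' s) (at s)"
      by (rule DERIV_add[OF d(1) c(1)[OF \<open>s \<in> I\<close>]])
    show "((\<lambda>y. \<phi> (y, s) + c s) has_derivative (\<lambda>h. g (x, s) \<bullet> h)) (at x)"
      using has_derivative_add[OF d(2) has_derivative_const[of "c s"]] by simp
    show "((\<lambda>y. g (y, s)) has_derivative (\<lambda>h. H (x, s) *v h)) (at x)"
      by (rule d(3))
  qed
  ultimately show ?thesis
    using assms(1) unfolding C21_on_def
    by (intro conjI ballI continuous_on_add) (simp_all add: split_paired_all)
qed

lemma viscosity_subsolutionD:
  assumes "viscosity_subsolution F Q v" "open U" "U \<subseteq> Q" "z \<in> U" "C21_on U \<phi> \<phi>t g H"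
    and "\<And>w. w \<in> U \<Longrightarrow> v w - \<phi> w \<le> v z - \<phi> z"
  shows "\<phi>t z \<le> F (H z)"
proof -
  have "\<phi>t z - F (H z) \<le> 0"
    using assms unfolding viscosity_subsolution_def by blast
  then show ?thesis by simp
qed

lemma viscosity_supersolutionD:
  assumes "viscosity_supersolution F Q v" "open U" "U \<subseteq> Q" "z \<in> U" "C21_on U \<phi> \<phi>t g H"
    and "\<And>w. w \<in> U \<Longrightarrow> v z - \<phi> z \<le> v w - \<phi> w"
  shows "F (H z) \<le> \<phi>t z"
proof -
  have "0 \<le> \<phi>t z - F (H z)"
    using assms unfolding viscosity_supersolution_def by blast
  then show ?thesis by simp
qed

lemma penalty_deriv:
  fixes T :: real
  assumes "s < T"
  shows "((\<lambda>s. c / (T - s)) has_real_derivative c / (T - s)\<^sup>2) (at s)"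
  using assms by (auto intro!: derivative_eq_intros simp: power2_eq_square)

text \<open>At an interior maximum of w - v - \<eta>/(T - s), the function w - \<eta>/(T - s)
  touches \<open>v\<close> from below, so F(H) \<le> wt - \<eta>/(T - s)^2 there. This contradicts
  wt \<le> F(H). Since \<open>v\<close> need not be continuous at \<Gamma> x {0}, the initial
  comparison uses only v \<ge> 0 and the uniform smallness of \<open>w\<close>.\<close>

lemma solution_ge_subsolution:
  fixes v w :: "(real^'n) \<times> real \<Rightarrow> real"
  assumes \<Omega>: "open \<Omega>" "bounded \<Omega>" and sol: "is_solution F \<Omega> v"
    and w: "C21_on (UNIV \<times> {0<..}) w wt g H"
    and sub: "\<And>z. z \<in> \<Omega> \<times> {0<..} \<Longrightarrow> wt z \<le> F (H z)"
    and le1: "\<And>y s. y \<in> closure \<Omega> \<Longrightarrow> 0 < s \<Longrightarrow> w (y, s) \<le> 1"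
    and small: "\<And>\<epsilon>. 0 < \<epsilon> \<Longrightarrow> \<exists>\<delta>>0. \<forall>y\<in>closure \<Omega>. \<forall>s. 0 < s \<and> s < \<delta> \<longrightarrow> w (y, s) \<le> \<epsilon>"
    and xt: "x \<in> \<Omega>" "0 < t"
  shows "w (x, t) \<le> v (x, t)"
proof (rule field_le_epsilon)
  fix \<eta> :: real assume \<eta>: "0 < \<eta>"
  \<comment> \<open>The penalty at time \<open>t\<close> is then exactly \<open>\<eta>\<close>, so
    failure of the claim means \<open>\<Psi> (x, t) > 0\<close>.\<close>
  define T where "T = t + 1"
  have T: "0 < T" using xt by (simp add: T_def)
  define \<Psi> where "\<Psi> z = w z - v z - \<eta> / (T - snd z)" for z
  have Dsub: "closure \<Omega> \<times> {0<..<T} \<subseteq> closure \<Omega> \<times> {0..} - frontier \<Omega> \<times> {0}" by auto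
  have v0: "0 \<le> v (y, s)" if "y \<in> closure \<Omega>" "0 < s" for y s
    using sol that unfolding is_solution_def Let_def by auto
  have v1: "v (y, s) = 1" if "y \<in> frontier \<Omega>" "0 < s" for y s
    using sol that unfolding is_solution_def by blast
  have contv: "continuous_on (closure \<Omega> \<times> {0<..<T}) v"
    using sol Dsub unfolding is_solution_def Let_def by (blast intro: continuous_on_subset)
  have contw: "continuous_on (closure \<Omega> \<times> {0<..<T}) w"
    using w unfolding C21_on_def by (auto elim: continuous_on_subset)
  have cont: "continuous_on (closure \<Omega> \<times> {0<..<T}) \<Psi>"
    unfolding \<Psi>_def using contv contw by (auto intro!: continuous_intros)
  \<comment> \<open>The penalty is at least \<open>\<eta> / T\<close> at all times, so a barrier
    below \<open>\<eta> / T\<close> settles the early times.\<close>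
  obtain \<delta> where \<delta>: "0 < \<delta>" "\<And>y s. y \<in> closure \<Omega> \<Longrightarrow> 0 < s \<Longrightarrow> s < \<delta> \<Longrightarrow> w (y, s) \<le> \<eta> / T"
    using small[of "\<eta> / T"] \<eta> T by auto
  have s1: "\<Psi> (y, s) \<le> 0"
    if "y \<in> closure \<Omega>" "0 < s" "s < T" "s < min \<delta> \<eta> \<or> T - min \<delta> \<eta> < s" for y s
  proof (cases "s < \<delta>")
    case True
    have "\<eta> / T \<le> \<eta> / (T - s)" using \<eta> that by (intro divide_left_mono) auto
    with \<delta>(2)[OF that(1,2) True] v0[OF that(1,2)] show ?thesis by (simp add: \<Psi>_def)
  next
    case False
    \<comment> \<open>Within \<open>\<eta>\<close> of the final time the penalty is at least 1, the
      upper bound of \<open>w\<close>.\<close>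
    then have "T - s \<le> \<eta>" using that by auto
    then have "1 \<le> \<eta> / (T - s)" using that by simp
    with le1[OF that(1,2)] v0[OF that(1,2)] show ?thesis by (simp add: \<Psi>_def)
  qed
  have lateral: "\<Psi> (y, s) \<le> 0" if "y \<in> frontier \<Omega>" "0 < s" "s < T" for y s
  proof -
    have "0 \<le> \<eta> / (T - s)" using that \<eta> by simp
    moreover have "w (y, s) \<le> 1" using le1 that by (simp add: frontier_def)
    ultimately show ?thesis using v1[OF that(1,2)] by (simp add: \<Psi>_def)
  qed
  show "w (x, t) \<le> v (x, t) + \<eta>"
  proof (rule ccontr)
    assume "\<not> ?thesis"
    then have pos: "\<Psi> (x, t) > 0" by (simp add: \<Psi>_def T_def)
    obtain y s where ys: "y \<in> \<Omega>" "0 < s" "s < T"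
      and max: "\<And>z. z \<in> \<Omega> \<times> {0<..<T} \<Longrightarrow> \<Psi> z \<le> \<Psi> (y, s)"
      by (rule interior_maximum[OF \<Omega> T cont, of "min \<delta> \<eta>" x t])
        (use \<delta>(1) \<eta> s1 lateral xt pos in \<open>auto simp: T_def\<close>)
    let ?\<phi>t = "\<lambda>z. wt z + - \<eta> / (T - snd z)\<^sup>2"
    have "C21_on (\<Omega> \<times> {0<..<T}) w wt g H"
      by (rule C21_on_subset[OF w]) auto
    then have "C21_on (\<Omega> \<times> {0<..<T}) (\<lambda>z. w z + - \<eta> / (T - snd z)) ?\<phi>t g H"
      by (rule C21_on_add_time[where I="{..<T}", OF _ _ penalty_deriv]) (auto intro!: continuous_intros)
    then have "F (H (y, s)) \<le> ?\<phi>t (y, s)"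
    proof (rule viscosity_supersolutionD[rotated 4])
      show "viscosity_supersolution F (\<Omega> \<times> {0<..}) v"
        using sol by (simp add: is_solution_def)
    next
      fix z assume "z \<in> \<Omega> \<times> {0<..<T}"
      from max[OF this] show "v (y, s) - (w (y, s) + - \<eta> / (T - snd (y, s))) \<le> v z - (w z + - \<eta> / (T - snd z))"
        by (simp add: \<Psi>_def)
    qed (use ys \<Omega> in \<open>auto intro!: open_Times\<close>)
    moreover have "0 < \<eta> / (T - s)\<^sup>2" using \<eta> ys by simp
    ultimately show False using sub[of "(y, s)"] ys by simp
  qed
qed

text \<open>The mirror argument on a ball whose closure stays inside \<Omega>. There
  \<open>v\<close> is continuous down to time 0, and on the sphere v \<le> 1 \<le> w, so no boundary
  data of \<open>v\<close> on \<Gamma> enter.\<close>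

lemma solution_le_supersolution:
  fixes v w :: "(real^'n) \<times> real \<Rightarrow> real"
  assumes sol: "is_solution F \<Omega> v" and \<Omega>: "open \<Omega>" and R: "cball p R \<subseteq> \<Omega>"
    and w: "C21_on (UNIV \<times> UNIV) w wt g H"
    and super: "\<And>z. z \<in> ball p R \<times> {0<..} \<Longrightarrow> F (H z) \<le> wt z"
    and ge0: "\<And>z. 0 \<le> w z"
    and ge1: "\<And>y s. dist p y = R \<Longrightarrow> 0 < s \<Longrightarrow> 1 \<le> w (y, s)"
    and xt: "x \<in> ball p R" "0 < t"
  shows "v (x, t) \<le> w (x, t)"
proof (rule field_le_epsilon)
  fix \<eta> :: real assume \<eta>: "0 < \<eta>"
  define T where "T = t + 1"
  have T: "0 < T" using xt by (simp add: T_def)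
  have R0: "0 < R" using xt(1) by (metis ball_eq_empty empty_iff not_le)
  define \<Psi> where "\<Psi> z = v z - w z - \<eta> / (T - snd z)" for z
  have "cball p R \<subseteq> closure \<Omega>" using R closure_subset[of \<Omega>] by blast
  moreover have "cball p R \<inter> frontier \<Omega> = {}" using R \<Omega> by (auto simp: frontier_def interior_open)
  ultimately have Dsub: "cball p R \<times> {0..T} \<subseteq> closure \<Omega> \<times> {0..} - frontier \<Omega> \<times> {0}" by auto
  have v_le1: "v (y, s) \<le> 1" if "y \<in> cball p R" "0 < s" "s < T" for y s
    using sol that Dsub unfolding is_solution_def Let_def by fastforce
  have v_init: "v (y, 0) = 0" if "y \<in> cball p R" for y
    using sol that R unfolding is_solution_def by blast
  have contv: "continuous_on (cball p R \<times> {0..T}) v"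
    using sol Dsub unfolding is_solution_def Let_def by (blast intro: continuous_on_subset)
  have contw: "continuous_on UNIV w"
    using w unfolding C21_on_def by simp
  have cont: "continuous_on (closure (ball p R) \<times> {0<..<T}) \<Psi>"
    unfolding \<Psi>_def using R0
    by (auto intro!: continuous_intros continuous_on_subset[OF contv] continuous_on_subset[OF contw])
  \<comment> \<open>Uniform continuity on a cylinder that includes time 0 makes \<open>v\<close>
    smaller than \<open>\<eta> / T\<close> at early times, uniformly on the ball.\<close>
  have "uniformly_continuous_on (cball p R \<times> {0..T}) v"
    using contv by (intro compact_uniformly_continuous compact_Times) auto
  then obtain \<delta> where \<delta>: "0 < \<delta>"
    "\<And>z z'. z \<in> cball p R \<times> {0..T} \<Longrightarrow> z' \<in> cball p R \<times> {0..T} \<Longrightarrow> dist z' z < \<delta> \<Longrightarrow> dist (v z') (v z) < \<eta> / T"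
    unfolding uniformly_continuous_on_def using \<eta> T by (metis divide_pos_pos)
  have s1: "\<Psi> (y, s) \<le> 0"
    if "y \<in> cball p R" "0 < s" "s < T" "s < min \<delta> \<eta> \<or> T - min \<delta> \<eta> < s" for y s
  proof (cases "s < \<delta>")
    case True
    have "\<eta> / T \<le> \<eta> / (T - s)" using \<eta> that by (intro divide_left_mono) auto
    moreover have "dist (v (y, s)) (v (y, 0)) < \<eta> / T"
      using that True T by (intro \<delta>(2)) (auto simp: dist_Pair_Pair)
    ultimately show ?thesis using ge0[of "(y, s)"] v_init[OF that(1)] by (simp add: \<Psi>_def dist_real_def)
  next
    case False
    then have "T - s \<le> \<eta>" using that by auto
    then have "1 \<le> \<eta> / (T - s)" using that by simp
    with v_le1[OF that(1-3)] ge0[of "(y, s)"] show ?thesis by (simp add: \<Psi>_def)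
  qed
  have lateral: "\<Psi> (y, s) \<le> 0" if "y \<in> frontier (ball p R)" "0 < s" "s < T" for y s
  proof -
    have "dist p y = R" using that(1) R0 by simp
    moreover have "0 \<le> \<eta> / (T - s)" using that \<eta> by simp
    ultimately show ?thesis using ge1[of y s] v_le1[of y s] that by (simp add: \<Psi>_def)
  qed
  show "v (x, t) \<le> w (x, t) + \<eta>"
  proof (rule ccontr)
    assume "\<not> ?thesis"
    then have pos: "\<Psi> (x, t) > 0" by (simp add: \<Psi>_def T_def)
    obtain y s where ys: "y \<in> ball p R" "0 < s" "s < T"
      and max: "\<And>z. z \<in> ball p R \<times> {0<..<T} \<Longrightarrow> \<Psi> z \<le> \<Psi> (y, s)"
      by (rule interior_maximum[OF open_ball bounded_ball T cont, of "min \<delta> \<eta>" x t])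
        (use R0 \<delta>(1) \<eta> s1 lateral xt pos in \<open>auto simp: T_def\<close>)
    let ?\<phi>t = "\<lambda>z. wt z + \<eta> / (T - snd z)\<^sup>2"
    have "C21_on (ball p R \<times> {0<..<T}) w wt g H"
      by (rule C21_on_subset[OF w]) auto
    then have "C21_on (ball p R \<times> {0<..<T}) (\<lambda>z. w z + \<eta> / (T - snd z)) ?\<phi>t g H"
      by (rule C21_on_add_time[where I="{..<T}", OF _ _ penalty_deriv]) (auto intro!: continuous_intros)
    then have "?\<phi>t (y, s) \<le> F (H (y, s))"
    proof (rule viscosity_subsolutionD[rotated 4])
      show "viscosity_subsolution F (\<Omega> \<times> {0<..}) v"
        using sol by (simp add: is_solution_def)
      show "ball p R \<times> {0<..<T} \<subseteq> \<Omega> \<times> {0<..}" using R by (auto simp: subset_iff)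
    next
      fix z assume "z \<in> ball p R \<times> {0<..<T}"
      from max[OF this] show "v z - (w z + \<eta> / (T - snd z)) \<le> v (y, s) - (w (y, s) + \<eta> / (T - snd (y, s)))"
        by (simp add: \<Psi>_def)
    qed (use ys in \<open>auto intro!: open_Times\<close>)
    moreover have "0 < \<eta> / (T - s)\<^sup>2" using \<eta> ys by simp
    ultimately show False using super[of "(y, s)"] ys by simp
  qed
qed

section \<open>A radial exponential\<close>

text \<open>Up to powers of \<open>r\<close> and a polynomial, \<open>radial_series m (r\<^sup>2)\<close> is \<open>cosh r\<close> or \<open>sinh r\<close>: the shift by
  \<open>m\<close> in the factorial absorbs the first-order term of the radial Laplacian.\<close>

definition radial_coeff :: "nat \<Rightarrow> nat \<Rightarrow> real" where
  "radial_coeff m k = 1 / fact (2 * k + m)"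

definition radial_series :: "nat \<Rightarrow> real \<Rightarrow> real" where
  "radial_series m q = (\<Sum>k. radial_coeff m k * q ^ k)"

definition radial_series' :: "nat \<Rightarrow> real \<Rightarrow> real" where
  "radial_series' m q = (\<Sum>k. diffs (radial_coeff m) k * q ^ k)"

definition radial_series'' :: "nat \<Rightarrow> real \<Rightarrow> real" where
  "radial_series'' m q = (\<Sum>k. diffs (diffs (radial_coeff m)) k * q ^ k)"

section \<open>Termwise calculus for the radial series\<close>

lemma summable_radial_coeff: "summable (\<lambda>k. radial_coeff m k * q ^ k)"
proof (rule summable_comparison_test')
  show "summable (\<lambda>k. \<bar>q\<bar> ^ k / fact k)"
    using summable_exp[of "\<bar>q\<bar>"] by (simp add: field_simps)
  fix k :: nat
  have "fact k \<le> (fact (2 * k + m) :: real)" by (rule fact_mono) simp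
  then show "norm (radial_coeff m k * q ^ k) \<le> \<bar>q\<bar> ^ k / fact k"
    by (simp add: radial_coeff_def abs_mult power_abs frac_le)
qed

lemma summable_diffs_radial_coeff:
  "summable (\<lambda>k. diffs (radial_coeff m) k * q ^ k)"
  "summable (\<lambda>k. diffs (diffs (radial_coeff m)) k * q ^ k)"
  by (intro termdiff_converges_all summable_radial_coeff)+

lemma diffs_radial_coeff_nonneg: "0 \<le> diffs (radial_coeff m) k" "0 \<le> diffs (diffs (radial_coeff m)) k"
  by (simp_all add: diffs_def radial_coeff_def)

lemma radial_series_deriv:
  "(radial_series m has_real_derivative radial_series' m q) (at q)"
  "(radial_series' m has_real_derivative radial_series'' m q) (at q)"
  unfolding radial_series_def[abs_def] radial_series'_def[abs_def] radial_series''_def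
  by (intro termdiffs_strong_converges_everywhere summable_radial_coeff summable_diffs_radial_coeff)+

lemma isCont_radial_series:
  "isCont (radial_series m) q" "isCont (radial_series' m) q" "isCont (radial_series'' m) q"
proof -
  show "isCont (radial_series m) q" "isCont (radial_series' m) q"
    using radial_series_deriv DERIV_isCont by blast+
  show "isCont (radial_series'' m) q"
    unfolding radial_series''_def[abs_def]
    by (rule DERIV_isCont, rule termdiffs_strong_converges_everywhere, rule summable_diffs_radial_coeff)
qed

lemma radial_series_nonneg:
  assumes "0 \<le> q"
  shows "0 \<le> radial_series' m q" "0 \<le> radial_series'' m q"
  unfolding radial_series'_def radial_series''_def
  using assms by (auto intro!: suminf_nonneg summable_diffs_radial_coeff mult_nonneg_nonneg diffs_radial_coeff_nonneg)

lemma radial_series_0: "radial_series m 0 = 1 / fact m"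
  unfolding radial_series_def powser_zero by (simp add: radial_coeff_def)

lemma radial_series_ge:
  assumes "0 \<le> q"
  shows "1 / fact m \<le> radial_series m q"
proof -
  have "(\<Sum>k<1. radial_coeff m k * q ^ k) \<le> radial_series m q"
    unfolding radial_series_def using assms
    by (intro sum_le_suminf summable_radial_coeff) (auto simp: radial_coeff_def)
  then show ?thesis by (simp add: radial_coeff_def)
qed

lemma radial_series_pos: "0 \<le> q \<Longrightarrow> 0 < radial_series m q"
  by (rule less_le_trans[OF _ radial_series_ge]) simp_all

text \<open>Since \<open>diffs c k\<close> is (k+1) times the next coefficient, the left side is the
  k-th coefficient of 2 n G' + 4 q G''. The quotient of consecutive factorials is (2k+2+m)(2k+1+m),
  which dominates (2n+4k)(k+1) = (2k+2)(2k+n) when n \<le> m.\<close>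

lemma radial_coeff_Suc:
  assumes "n \<le> m"
  shows "(2 * real n + 4 * real k) * diffs (radial_coeff m) k \<le> radial_coeff m k"
proof -
  have "fact (2 * Suc k + m) = real (2 * k + 2 + m) * real (2 * k + 1 + m) * fact (2 * k + m)"
    by (simp add: algebra_simps)
  then have eq: "diffs (radial_coeff m) k
      = (real k + 1) / (real (2 * k + 2 + m) * real (2 * k + 1 + m)) * radial_coeff m k"
    unfolding diffs_def radial_coeff_def by (simp only:) (simp add: mult.assoc add.commute)
  have "(2 * real n + 4 * real k) * (real k + 1) = real (2 * k + 2) * real (2 * k + n)"
    by (simp add: algebra_simps)
  also have "\<dots> \<le> real (2 * k + 2 + m) * real (2 * k + 1 + m)"
    using assms by (intro mult_mono) auto
  finally have "(2 * real n + 4 * real k) * ((real k + 1) / (real (2 * k + 2 + m) * real (2 * k + 1 + m))) \<le> 1"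
    by (subst times_divide_eq_right, subst divide_le_eq_1_pos) auto
  then show ?thesis
    unfolding eq mult.assoc[symmetric]
    by (rule mult_left_le_one_le[rotated 2]) (auto simp: radial_coeff_def)
qed

text \<open>The left side is the Laplacian in dimension \<open>n\<close> of the function G(|y|^2),
  so this is the inequality \<Delta>h \<le> h; it holds coefficient by coefficient.\<close>

lemma radial_series_supersolution:
  assumes "n \<le> m" "0 \<le> q"
  shows "2 * real n * radial_series' m q + 4 * q * radial_series'' m q \<le> radial_series m q"
proof -
  define b where "b = diffs (radial_coeff m)"
  have "(\<lambda>k. diffs b k * q ^ k) sums radial_series'' m q"
    unfolding radial_series''_def b_def by (intro summable_sums summable_diffs_radial_coeff)
  from sums_mult[OF this, of q] have "(\<lambda>k. real (Suc k) * b (Suc k) * q ^ Suc k) sums (q * radial_series'' m q)"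
    by (simp add: diffs_def mult_ac)
  \<comment> \<open>Multiplying by \<open>q\<close> shifts the index by one; the new term at k = 0
    is zero.\<close>
  then have "(\<lambda>k. real k * b k * q ^ k) sums (q * radial_series'' m q)"
    by (subst (asm) sums_Suc_iff) simp
  moreover have "(\<lambda>k. b k * q ^ k) sums radial_series' m q"
    unfolding radial_series'_def b_def by (intro summable_sums summable_diffs_radial_coeff)
  ultimately have sums: "(\<lambda>k. 2 * real n * (b k * q ^ k) + 4 * (real k * b k * q ^ k)) sums
      (2 * real n * radial_series' m q + 4 * (q * radial_series'' m q))"
    by (intro sums_add sums_mult)
  have sums': "(\<lambda>k. radial_coeff m k * q ^ k) sums radial_series m q"
    unfolding radial_series_def by (intro summable_sums summable_radial_coeff)
  have "2 * real n * (b k * q ^ k) + 4 * (real k * b k * q ^ k) \<le> radial_coeff m k * q ^ k" for k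
    using mult_right_mono[OF radial_coeff_Suc[OF assms(1), of k], of "q ^ k"] assms(2)
    by (simp add: b_def algebra_simps)
  from sums_le[OF this sums sums'] show ?thesis by (simp add: mult.assoc)
qed

lemma cosh_sums_even: "(\<lambda>k. x ^ (2 * k) / fact (2 * k)) sums cosh (x :: real)"
proof -
  let ?f = "\<lambda>n. if even n then x ^ n /\<^sub>R fact n else 0"
  have "(\<lambda>k. ?f (2 * k)) sums cosh x"
    using cosh_converges[of x]
    by (subst sums_mono_reindex[of "\<lambda>k. 2 * k" ?f]) (auto simp: strict_mono_def elim!: evenE)
  then show ?thesis by (simp add: divide_inverse mult.commute)
qed

text \<open>With shift 2n the series is the tail of cosh r from index n on, divided by r^(2n). The n
  missing terms are each at most (1+r)^(2n) and are absorbed through 1 \<le> (2n)! G; the factor 2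
  comes from exp r \<le> 2 cosh r.\<close>

lemma exp_le_radial_series:
  assumes "0 \<le> r"
  shows "exp r \<le> 2 * (1 + real n * fact (2 * n)) * (1 + r) ^ (2 * n) * radial_series (2 * n) (r\<^sup>2)"
proof -
  let ?G = "radial_series (2 * n) (r\<^sup>2)"
  have G: "1 \<le> fact (2 * n) * ?G"
    using radial_series_ge[of "r\<^sup>2" "2 * n"] by (simp add: field_simps)
  have "cosh r = (\<Sum>k. r ^ (2 * (k + n)) / fact (2 * (k + n))) + (\<Sum>k<n. r ^ (2 * k) / fact (2 * k))"
    using suminf_split_initial_segment[OF sums_summable[OF cosh_sums_even[of r]], of n]
    by (simp add: sums_unique[OF cosh_sums_even])
  also have "(\<Sum>k. r ^ (2 * (k + n)) / fact (2 * (k + n))) = r ^ (2 * n) * ?G"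
    unfolding radial_series_def
    by (subst suminf_mult[symmetric, OF summable_radial_coeff])
       (simp add: radial_coeff_def distrib_left power_add mult.commute flip: power_mult)
  also have "\<dots> \<le> (1 + r) ^ (2 * n) * ?G"
    using assms radial_series_ge[of "r\<^sup>2" "2 * n"]
    by (intro mult_right_mono power_mono) (auto intro: order_trans[OF _ radial_series_ge])
  also have "(\<Sum>k<n. r ^ (2 * k) / fact (2 * k)) \<le> (\<Sum>k<n. (1 + r) ^ (2 * n))"
  proof (rule sum_mono)
    fix k assume "k \<in> {..<n}"
    have "r ^ (2 * k) / fact (2 * k) \<le> r ^ (2 * k) / 1"
      using assms by (intro divide_left_mono) (auto simp: fact_ge_1)
    also have "\<dots> \<le> (1 + r) ^ (2 * k)" using assms by (simp add: power_mono)
    also have "\<dots> \<le> (1 + r) ^ (2 * n)" using assms \<open>k \<in> _\<close> by (intro power_increasing) auto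
    finally show "r ^ (2 * k) / fact (2 * k) \<le> (1 + r) ^ (2 * n)" .
  qed
  also have "\<dots> \<le> real n * (1 + r) ^ (2 * n) * (fact (2 * n) * ?G)"
    using G assms mult_left_mono[OF G, of "real n * (1 + r) ^ (2 * n)"] by simp
  finally have "cosh r \<le> (1 + real n * fact (2 * n)) * (1 + r) ^ (2 * n) * ?G"
    by (simp add: algebra_simps)
  moreover have "exp r \<le> 2 * cosh r" by (simp add: cosh_field_def)
  ultimately show ?thesis
    unfolding mult.assoc by linarith
qed

section \<open>Upper and lower bounds by radial barriers\<close>

text \<open>The profile is increasing and convex in q, so \<open>F\<close> of its Hessian is at most
  \<mu> times its Laplacian, hence at most \<open>\<mu> * \<kappa>\<^sup>2\<close> times the
  function itself. That is the time derivative produced by the exponential factor.\<close>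

lemma upper_bound_ball:
  fixes v :: "(real^'n) \<times> real \<Rightarrow> real"
  assumes sol: "is_solution F \<Omega> v" and \<Omega>: "open \<Omega>" and F: "radial_bounds F \<mu> \<Lambda>"
    and R: "cball x R \<subseteq> \<Omega>" "0 < R" and "0 < t" "0 \<le> \<kappa>" and N: "N = CARD('n)"
  shows "v (x, t) \<le> exp (\<mu> * \<kappa>\<^sup>2 * t) / radial_series (2 * N) ((\<kappa> * R)\<^sup>2)"
proof -
  define m where "m = 2 * N"
  \<comment> \<open>This normalizes the barrier to 1 on the sphere of radius \<open>R\<close> at
    time 0; the growth in time keeps it at least 1 later.\<close>
  define A where "A = 1 / radial_series m ((\<kappa> * R)\<^sup>2)"
  note G_pos = radial_series_pos[of _ m]
  have A: "0 < A" unfolding A_def using G_pos by simp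
  define f where "f q s = A * exp (\<mu> * \<kappa>\<^sup>2 * s) * radial_series m (\<kappa>\<^sup>2 * q)" for q s
  define fq where "fq q s = A * exp (\<mu> * \<kappa>\<^sup>2 * s) * (\<kappa>\<^sup>2 * radial_series' m (\<kappa>\<^sup>2 * q))" for q s
  define fqq where "fqq q s = A * exp (\<mu> * \<kappa>\<^sup>2 * s) * (\<kappa>^4 * radial_series'' m (\<kappa>\<^sup>2 * q))" for q s
  define fs where "fs q s = \<mu> * \<kappa>\<^sup>2 * f q s" for q s
  have contG: "continuous_on UNIV (\<lambda>z. h (\<kappa>\<^sup>2 * fst z))" if "\<And>q. isCont h q" for h :: "real \<Rightarrow> real"
    by (rule continuous_on_compose2[where t=UNIV and g=h])
       (auto intro!: continuous_intros continuous_at_imp_continuous_on that)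
  note contG = contG[OF isCont_radial_series(1)] contG[OF isCont_radial_series(2)] contG[OF isCont_radial_series(3)]
  let ?w = "\<lambda>(y, s). f ((norm (y - x))\<^sup>2) s"
  let ?H = "\<lambda>(y, s). outer_pert (2 * fq ((norm (y - x))\<^sup>2) s) (4 * fqq ((norm (y - x))\<^sup>2) s) (y - x)"
  have "C21_on (UNIV \<times> UNIV) ?w (\<lambda>(y, s). fs ((norm (y - x))\<^sup>2) s)
    (\<lambda>(y, s). (2 * fq ((norm (y - x))\<^sup>2) s) *\<^sub>R (y - x)) ?H"
  proof (rule C21_on_radial)
    show "continuous_on (UNIV \<times> UNIV) (\<lambda>(q, s). f q s)" "continuous_on (UNIV \<times> UNIV) (\<lambda>(q, s). fs q s)"
      "continuous_on (UNIV \<times> UNIV) (\<lambda>(q, s). fq q s)" "continuous_on (UNIV \<times> UNIV) (\<lambda>(q, s). fqq q s)"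
      unfolding f_def fs_def fq_def fqq_def case_prod_beta'
      using contG by (auto intro!: continuous_intros)
    fix q s :: real
    show "((\<lambda>s. f q s) has_real_derivative fs q s) (at s)"
      unfolding f_def fs_def by (auto intro!: derivative_eq_intros)
    have scale: "((\<lambda>q. c * h (\<kappa>\<^sup>2 * q)) has_real_derivative c * (\<kappa>\<^sup>2 * h' (\<kappa>\<^sup>2 * q))) (at q)"
      if "\<And>q. (h has_real_derivative h' q) (at q)" for c and h h' :: "real \<Rightarrow> real"
    proof -
      have "((\<lambda>q. \<kappa>\<^sup>2 * q) has_real_derivative \<kappa>\<^sup>2) (at q)"
        by (auto intro!: derivative_eq_intros)
      from DERIV_cmult[OF DERIV_chain2[OF that this], of c] show ?thesis
        by (simp only: mult.commute[of "\<kappa>\<^sup>2" "h' _"])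
    qed
    show "((\<lambda>q. f q s) has_real_derivative fq q s) (at q)"
      unfolding f_def fq_def by (rule scale[OF radial_series_deriv(1)])
    show "((\<lambda>q. fq q s) has_real_derivative fqq q s) (at q)"
      using scale[OF radial_series_deriv(2), of "A * exp (\<mu> * \<kappa>\<^sup>2 * s) * \<kappa>\<^sup>2" m]
      unfolding fq_def fqq_def by (simp add: mult.assoc power4_eq_xxxx power2_eq_square)
  qed
  moreover have "F (?H z) \<le> (\<lambda>(y, s). fs ((norm (y - x))\<^sup>2) s) z" for z
  proof -
    obtain y s where z: "z = (y, s)" by (cases z)
    define q where "q = (norm (y - x))\<^sup>2"
    define E where "E = A * exp (\<mu> * \<kappa>\<^sup>2 * s)"
    have q: "0 \<le> \<kappa>\<^sup>2 * q" by (simp add: q_def)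
    have E: "0 < E" using A by (simp add: E_def)
    have "0 \<le> fq q s" "0 \<le> fqq q s"
      using q radial_series_nonneg[OF q, of m] A by (auto simp: fq_def fqq_def)
    then have "F (?H z) \<le> \<mu> * (real N * (2 * fq q s) + 4 * fqq q s * q)"
      using F unfolding radial_bounds_def z q_def N by auto
    also have "\<dots> = \<mu> * (E * \<kappa>\<^sup>2 * (2 * real N * radial_series' m (\<kappa>\<^sup>2 * q) + 4 * (\<kappa>\<^sup>2 * q) * radial_series'' m (\<kappa>\<^sup>2 * q)))"
      unfolding fq_def fqq_def E_def by (simp add: algebra_simps power4_eq_xxxx power2_eq_square)
    also have "\<dots> \<le> \<mu> * (E * \<kappa>\<^sup>2 * radial_series m (\<kappa>\<^sup>2 * q))"
      using F E radial_series_supersolution[OF _ q, of N m]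
      by (intro mult_left_mono) (auto simp: radial_bounds_def m_def)
    finally show ?thesis by (simp add: z fs_def f_def q_def E_def mult_ac)
  qed
  moreover have "0 \<le> ?w z" for z
  proof -
    obtain y s where z: "z = (y, s)" by (cases z)
    have "0 < radial_series m (\<kappa>\<^sup>2 * (norm (y - x))\<^sup>2)" by (rule G_pos) simp
    then show ?thesis using A by (simp add: z f_def)
  qed
  moreover have "1 \<le> ?w (y, s)" if "dist x y = R" "0 < s" for y s
  proof -
    have "1 \<le> exp (\<mu> * \<kappa>\<^sup>2 * s)" using F that by (auto simp: radial_bounds_def)
    moreover have "(norm (y - x))\<^sup>2 = R\<^sup>2" using that by (simp add: dist_norm norm_minus_commute)
    ultimately show ?thesis
      using G_pos[of "(\<kappa> * R)\<^sup>2"] by (simp add: f_def A_def power_mult_distrib)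
  qed
  ultimately have "v (x, t) \<le> ?w (x, t)"
    using \<open>0 < R\<close> \<open>0 < t\<close> by (intro solution_le_supersolution[OF sol \<Omega> R(1)]) auto
  \<comment> \<open>At the centre the series has the value 1/m!, which is at most 1.\<close>
  also have "\<dots> \<le> A * exp (\<mu> * \<kappa>\<^sup>2 * t)"
    using A fact_ge_1[of m, where 'a=real] by (simp add: f_def radial_series_0 divide_le_eq)
  finally show ?thesis by (simp add: A_def m_def)
qed

text \<open>A ball is connected, so one that meets both \<Omega> and its complement contains a
  boundary point.\<close>

lemma cball_subset_of_infdist:
  fixes x :: "'a::euclidean_space"
  assumes "open \<Omega>" "x \<in> \<Omega>" "0 \<le> R" "R < infdist x (frontier \<Omega>)"
  shows "cball x R \<subseteq> \<Omega>"
proof (rule ccontr)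
  assume "\<not> ?thesis"
  then have "cball x R - \<Omega> \<noteq> {}" by auto
  moreover have "cball x R \<inter> \<Omega> \<noteq> {}" using assms by force
  ultimately have "cball x R \<inter> frontier \<Omega> \<noteq> {}"
    by (intro connected_Int_frontier) (auto simp: convex_connected)
  then obtain z where "z \<in> frontier \<Omega>" "dist x z \<le> R" by auto
  with infdist_le[of z "frontier \<Omega>" x] assms(4) show False by simp
qed

lemma solution_upper_bound:
  fixes v :: "(real^'n) \<times> real \<Rightarrow> real"
  assumes sol: "is_solution F \<Omega> v" and \<Omega>: "open \<Omega>" and F: "radial_bounds F \<mu> \<Lambda>"
    and x: "x \<in> \<Omega>" and t: "0 < t" and d: "d = infdist x (frontier \<Omega>)" "0 < d" and N: "N = CARD('n)"
  shows "v (x, t) \<le> 2 * (1 + real N * fact (2 * N)) * (1 + d\<^sup>2 / (2 * \<mu> * t)) ^ (2 * N) * exp (- d\<^sup>2 / (4 * \<mu> * t))"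
proof -
  have \<mu>: "0 < \<mu>" using F by (simp add: radial_bounds_def)
  \<comment> \<open>This value minimizes the exponent
    \<open>\<mu> * \<kappa>\<^sup>2 * t - \<kappa> * d\<close>.\<close>
  define \<kappa> where "\<kappa> = d / (2 * \<mu> * t)"
  define C where "C = 2 * (1 + real N * fact (2 * N))"
  have C: "0 < C" unfolding C_def by (simp add: add_pos_nonneg)
  have \<kappa>: "0 < \<kappa>" using d t \<mu> by (simp add: \<kappa>_def)
  have bound: "v (x, t) \<le> exp (\<mu> * \<kappa>\<^sup>2 * t) * (C * (1 + \<kappa> * R) ^ (2 * N) * exp (- \<kappa> * R))" if "0 < R" "R < d" for R
  proof -
    have r: "0 \<le> \<kappa> * R" using \<kappa> that by simp
    have G: "0 < radial_series (2 * N) ((\<kappa> * R)\<^sup>2)"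
      by (rule radial_series_pos) simp
    have "1 / radial_series (2 * N) ((\<kappa> * R)\<^sup>2) \<le> C * (1 + \<kappa> * R) ^ (2 * N) * exp (- (\<kappa> * R))"
      using exp_le_radial_series[OF r, of N] G
      by (simp add: C_def exp_minus field_simps)
    then have "exp (\<mu> * \<kappa>\<^sup>2 * t) * (1 / radial_series (2 * N) ((\<kappa> * R)\<^sup>2))
        \<le> exp (\<mu> * \<kappa>\<^sup>2 * t) * (C * (1 + \<kappa> * R) ^ (2 * N) * exp (- \<kappa> * R))"
      by (intro mult_left_mono) auto
    with upper_bound_ball[OF sol \<Omega> F cball_subset_of_infdist[OF \<Omega> x] \<open>0 < R\<close> t less_imp_le[OF \<kappa>] N] that d
    show ?thesis by simp
  qed
  \<comment> \<open>The closed balls must stay inside \<Omega>, so the bound is available for R < d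
    only; continuity in \<open>R\<close> carries it to R = d.\<close>
  have "((\<lambda>R. exp (\<mu> * \<kappa>\<^sup>2 * t) * (C * (1 + \<kappa> * R) ^ (2 * N) * exp (- \<kappa> * R)))
      \<longlongrightarrow> exp (\<mu> * \<kappa>\<^sup>2 * t) * (C * (1 + \<kappa> * d) ^ (2 * N) * exp (- \<kappa> * d))) (at_left d)"
    by (intro tendsto_intros)
  moreover have "eventually (\<lambda>R. v (x, t) \<le> exp (\<mu> * \<kappa>\<^sup>2 * t) * (C * (1 + \<kappa> * R) ^ (2 * N) * exp (- \<kappa> * R))) (at_left d)"
    using eventually_at_left_real[OF d(2)] by eventually_elim (use bound in auto)
  ultimately have "v (x, t) \<le> exp (\<mu> * \<kappa>\<^sup>2 * t) * (C * (1 + \<kappa> * d) ^ (2 * N) * exp (- \<kappa> * d))"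
    by (rule tendsto_lowerbound) (simp add: trivial_limit_at_left_real)
  also have "\<dots> = C * (1 + \<kappa> * d) ^ (2 * N) * exp (\<mu> * \<kappa>\<^sup>2 * t - \<kappa> * d)"
    by (simp add: exp_diff exp_minus field_simps)
  also have "\<kappa> * d = d\<^sup>2 / (2 * \<mu> * t)" by (simp add: \<kappa>_def power2_eq_square)
  also have "\<mu> * \<kappa>\<^sup>2 * t - d\<^sup>2 / (2 * \<mu> * t) = - d\<^sup>2 / (4 * \<mu> * t)"
    using \<mu> t by (simp add: \<kappa>_def field_simps power2_eq_square)
  finally show ?thesis by (simp add: C_def)
qed

text \<open>The barrier is a Gaussian times t^(-k). It decreases and is convex in q, and with this
  \<open>k\<close> the lower estimate in \<open>radial_bounds\<close> equals its time derivative
  exactly. The constant in the exponent normalizes its maximum over |y - p| \<ge> \<rho> to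
  1.\<close>

lemma solution_lower_bound:
  fixes v :: "(real^'n) \<times> real \<Rightarrow> real"
  assumes sol: "is_solution F \<Omega> v" and \<Omega>: "open \<Omega>" "bounded \<Omega>" and F: "radial_bounds F \<mu> \<Lambda>"
    and \<rho>: "0 < \<rho>" "\<And>y. y \<in> \<Omega> \<Longrightarrow> \<rho> \<le> norm (y - p)" and x: "x \<in> \<Omega>" and t: "0 < t"
    and k: "k = real CARD('n) * \<Lambda> / (2 * \<mu>)"
  shows "exp (k * (1 + ln (\<rho>\<^sup>2 / (4 * \<mu> * k)) - ln t) - (norm (x - p))\<^sup>2 / (4 * \<mu> * t)) \<le> v (x, t)"
proof -
  have \<mu>: "0 < \<mu>" and \<Lambda>: "0 < \<Lambda>" using F by (auto simp: radial_bounds_def)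
  have k0: "0 < k" unfolding k using \<mu> \<Lambda> by simp
  define c where "c = \<rho>\<^sup>2 / (4 * \<mu> * k)"
  have c: "0 < c" unfolding c_def using \<mu> k0 \<rho> by simp
  define f where "f q s = exp (k * (1 + ln c - ln s) - q / (4 * \<mu> * s))" for q s
  define fq where "fq q s = - f q s / (4 * \<mu> * s)" for q s
  define fqq where "fqq q s = f q s / (4 * \<mu> * s)\<^sup>2" for q s
  define fs where "fs q s = f q s * (q / (4 * \<mu> * s\<^sup>2) - k / s)" for q s
  let ?w = "\<lambda>(y, s). f ((norm (y - p))\<^sup>2) s"
  let ?H = "\<lambda>(y, s). outer_pert (2 * fq ((norm (y - p))\<^sup>2) s) (4 * fqq ((norm (y - p))\<^sup>2) s) (y - p)"
  have C21: "C21_on (UNIV \<times> {0<..}) ?w (\<lambda>(y, s). fs ((norm (y - p))\<^sup>2) s)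
    (\<lambda>(y, s). (2 * fq ((norm (y - p))\<^sup>2) s) *\<^sub>R (y - p)) ?H"
  proof (rule C21_on_radial)
    show "continuous_on (UNIV \<times> {0<..}) (\<lambda>(q, s). f q s)" "continuous_on (UNIV \<times> {0<..}) (\<lambda>(q, s). fs q s)"
      "continuous_on (UNIV \<times> {0<..}) (\<lambda>(q, s). fq q s)" "continuous_on (UNIV \<times> {0<..}) (\<lambda>(q, s). fqq q s)"
      unfolding fs_def fq_def fqq_def f_def case_prod_beta'
      using \<mu> by (auto intro!: continuous_intros)
    fix q s :: real assume "s \<in> {0<..}"
    then have s: "0 < s" by simp
    show "((\<lambda>s. f q s) has_real_derivative fs q s) (at s)"
      unfolding f_def fs_def using s \<mu>
      by (auto intro!: derivative_eq_intros simp: field_simps power2_eq_square)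
    show "((\<lambda>q. f q s) has_real_derivative fq q s) (at q)"
      unfolding f_def fq_def using s \<mu> by (auto intro!: derivative_eq_intros)
    then show "((\<lambda>q. fq q s) has_real_derivative fqq q s) (at q)"
      unfolding fq_def fqq_def using s \<mu>
      by (auto intro!: derivative_eq_intros simp: power2_eq_square)
  qed
  have sub: "(\<lambda>(y, s). fs ((norm (y - p))\<^sup>2) s) z \<le> F (?H z)" if z: "z \<in> \<Omega> \<times> {0<..}" for z
  proof -
    obtain y s where z: "z = (y, s)" and s: "0 < s" using z by auto
    define q where "q = (norm (y - p))\<^sup>2"
    have f0: "0 < f q s" by (simp add: f_def)
    then have "fq q s \<le> 0" "0 \<le> fqq q s" using s \<mu> by (auto simp: fq_def fqq_def)
    then have "real CARD('n) * \<Lambda> * (2 * fq q s) + \<mu> * (4 * fqq q s) * q \<le> F (?H z)"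
      using F unfolding radial_bounds_def z q_def by auto
    moreover have "real CARD('n) * \<Lambda> = 2 * \<mu> * k" using k \<mu> by simp
    moreover have "2 * \<mu> * k * (2 * fq q s) + \<mu> * (4 * fqq q s) * q = fs q s"
      unfolding fq_def fqq_def fs_def using \<mu> s by (simp add: field_simps power2_eq_square)
    ultimately show ?thesis by (simp add: z q_def)
  qed
  have dist: "\<rho>\<^sup>2 \<le> (norm (y - p))\<^sup>2" if "y \<in> closure \<Omega>" for y
  proof -
    have "\<rho> \<le> norm (y - p)"
    proof (rule continuous_ge_on_closure[OF _ that])
      show "continuous_on (closure \<Omega>) (\<lambda>y. norm (y - p))" by (intro continuous_intros)
    qed (use \<rho> in auto)
    with \<rho> show ?thesis by simp
  qed
  \<comment> \<open>Monotonicity in \<open>q\<close> reduces all bounds on the closure of \<Omega>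
    to the single profile at \<open>\<rho>\<^sup>2\<close>.\<close>
  have f_le: "f q s \<le> f (\<rho>\<^sup>2) s" if "\<rho>\<^sup>2 \<le> q" "0 < s" for q s
    using that \<mu> by (simp add: f_def divide_right_mono)
  have f_rho: "f (\<rho>\<^sup>2) s \<le> 1" if "0 < s" for s
  proof -
    \<comment> \<open>\<open>c\<close> is the time at which the profile at
      \<open>\<rho>\<^sup>2\<close> is largest: the exponent becomes k (1 + ln(c/s) - c/s), which is
      at most 0 and vanishes at s = c.\<close>
    have "\<rho>\<^sup>2 / (4 * \<mu> * s) = k * (c / s)" using \<mu> k0 by (simp add: c_def)
    moreover have "ln c - ln s = ln (c / s)" using c that by (simp add: ln_div)
    ultimately have "k * (1 + ln c - ln s) - \<rho>\<^sup>2 / (4 * \<mu> * s) = k * (1 + ln (c / s) - c / s)"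
      by (simp add: algebra_simps)
    moreover have "ln (c / s) \<le> c / s - 1" using c that by (intro ln_le_minus_one) simp
    ultimately have "k * (1 + ln c - ln s) - \<rho>\<^sup>2 / (4 * \<mu> * s) \<le> 0"
      using k0 by (simp add: mult_le_0_iff)
    then show ?thesis by (simp add: f_def)
  qed
  have le1: "?w (y, s) \<le> 1" if "y \<in> closure \<Omega>" "0 < s" for y s
    using f_le[OF dist[OF that(1)] that(2)] f_rho[OF that(2)] by simp
  have "((\<lambda>s. exp (k * (1 + ln c - ln s) - a / s)) \<longlongrightarrow> 0) (at_right 0)" if "0 < a" for a
    using that k0 by real_asymp
  from this[of "\<rho>\<^sup>2 / (4 * \<mu>)"] have "(f (\<rho>\<^sup>2) \<longlongrightarrow> 0) (at_right 0)"
    using \<mu> \<rho> by (simp add: f_def[abs_def])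
  have small: "\<exists>\<delta>>0. \<forall>y\<in>closure \<Omega>. \<forall>s. 0 < s \<and> s < \<delta> \<longrightarrow> ?w (y, s) \<le> \<epsilon>" if "0 < \<epsilon>" for \<epsilon>
  proof -
    have "eventually (\<lambda>s. f (\<rho>\<^sup>2) s < \<epsilon>) (at_right 0)"
      using order_tendstoD(2)[OF \<open>(f (\<rho>\<^sup>2) \<longlongrightarrow> 0) (at_right 0)\<close> that] .
    then obtain \<delta> where "0 < \<delta>" "\<And>s. 0 < s \<Longrightarrow> s < \<delta> \<Longrightarrow> f (\<rho>\<^sup>2) s < \<epsilon>"
      unfolding eventually_at_right_field by auto
    then show ?thesis
      using f_le[OF dist] by (intro exI[of _ \<delta>]) (force intro: less_imp_le le_less_trans)
  qed
  have "?w (x, t) \<le> v (x, t)"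
    by (rule solution_ge_subsolution[OF \<Omega> sol C21 sub le1 small x t])
  then show ?thesis by (simp add: f_def c_def)
qed

section \<open>Exterior balls for domains of class \<open>C\<^sup>0\<^sup>,\<^sup>\<omega>\<close>\<close>

lemma psi_le:
  assumes "0 \<le> s"
  shows "psi \<omega> \<sigma> \<le> sqrt (s\<^sup>2 + (\<omega> s - \<sigma>)\<^sup>2)"
  unfolding psi_def using assms by (intro cINF_lower bdd_belowI2[of _ 0]) auto

lemma psi_le_self:
  assumes "modulus \<omega>" "0 < \<sigma>"
  shows "psi \<omega> \<sigma> \<le> \<sigma>"
  using psi_le[of 0 \<omega> \<sigma>] assms by (simp add: modulus_def)

lemma modulus_small:
  assumes "modulus \<omega>" "0 < \<epsilon>"
  obtains \<delta> where "0 < \<delta>" "\<And>s. 0 < s \<Longrightarrow> s < \<delta> \<Longrightarrow> \<omega> s < \<epsilon>"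
proof -
  have "eventually (\<lambda>s. \<omega> s < \<epsilon>) (at_right 0)"
    using assms by (intro order_tendstoD(2)[of _ 0]) (auto simp: modulus_def)
  then show thesis using that unfolding eventually_at_right_field by auto
qed

text \<open>For small s the graph of \<omega> stays at least \<sigma>/2 below the height \<sigma>;
  for s \<ge> \<delta> the horizontal distance is already at least \<delta>.\<close>

lemma psi_pos:
  assumes "modulus \<omega>" "0 < \<sigma>"
  shows "0 < psi \<omega> \<sigma>"
proof -
  obtain \<delta> where \<delta>: "0 < \<delta>" "\<And>s. 0 < s \<Longrightarrow> s < \<delta> \<Longrightarrow> \<omega> s < \<sigma> / 2"
    using modulus_small[OF assms(1), of "\<sigma> / 2"] assms(2) by auto
  have "min \<delta> (\<sigma> / 2) \<le> sqrt (s\<^sup>2 + (\<omega> s - \<sigma>)\<^sup>2)" if "0 \<le> s" for s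
  proof (cases "s < \<delta>")
    case True
    have "\<omega> s < \<sigma> / 2"
      using True \<delta>(2)[of s] that assms by (cases "s = 0") (auto simp: modulus_def)
    then have "\<sigma> / 2 \<le> \<bar>\<omega> s - \<sigma>\<bar>" by linarith
    also have "\<dots> \<le> sqrt (s\<^sup>2 + (\<omega> s - \<sigma>)\<^sup>2)" by (rule real_le_rsqrt) simp
    finally show ?thesis by simp
  next
    case False
    have "s \<le> sqrt (s\<^sup>2 + (\<omega> s - \<sigma>)\<^sup>2)" by (rule real_sqrt_sum_squares_ge1)
    with False show ?thesis by linarith
  qed
  then have "min \<delta> (\<sigma> / 2) \<le> psi \<omega> \<sigma>"
    unfolding psi_def by (intro cINF_greatest) auto
  then show ?thesis using \<delta>(1) assms(2) by simp
qed

text \<open>\<open>psi\<close> is the distance from (0, \<sigma>) to the graph of \<omega> over s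
  \<ge> 0; this extends the bound to points (s, a) under the graph. If the graph is at or below
  height \<sigma> at s, lowering the point only moves it away. Otherwise the graph crosses height
  \<sigma> at some s0 \<le> s, at distance s0.\<close>

lemma psi_le_below_graph:
  assumes \<omega>: "modulus \<omega>" and "0 < \<sigma>" "0 \<le> s" "a \<le> \<omega> s"
  shows "psi \<omega> \<sigma> \<le> sqrt (s\<^sup>2 + (a - \<sigma>)\<^sup>2)"
proof (cases "\<omega> s \<le> \<sigma>")
  case True
  then have "(\<omega> s - \<sigma>)\<^sup>2 \<le> (a - \<sigma>)\<^sup>2"
    using assms(4) by (intro abs_le_square_iff[THEN iffD1]) auto
  with psi_le[OF assms(3), of \<omega> \<sigma>] show ?thesis
    by (smt (verit) real_sqrt_le_mono)
next
  case False
  with \<omega> assms have s: "0 < s" by (cases "s = 0") (auto simp: modulus_def)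
  obtain \<delta> where \<delta>: "0 < \<delta>" "\<And>s. 0 < s \<Longrightarrow> s < \<delta> \<Longrightarrow> \<omega> s < \<sigma>"
    using modulus_small[OF \<omega> \<open>0 < \<sigma>\<close>] by auto
  \<comment> \<open>Continuity of \<omega> is given on positive arguments only, so the intermediate
    value theorem starts at a positive \<open>s'\<close> where \<omega> is still below
    \<sigma>.\<close>
  define s' where "s' = min s \<delta> / 2"
  have s': "0 < s'" "s' < \<delta>" "s' \<le> s" using s \<delta>(1) by (auto simp: s'_def min_def)
  have "continuous_on {s'..s} \<omega>"
    using \<omega> s' by (auto simp: modulus_def intro: continuous_on_subset)
  then obtain s0 where s0: "s' \<le> s0" "s0 \<le> s" "\<omega> s0 = \<sigma>"
    using IVT'[of \<omega> s' \<sigma> s] \<delta>(2)[of s'] s' False by auto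
  then have "psi \<omega> \<sigma> \<le> s0" using psi_le[of s0 \<omega> \<sigma>] s' by simp
  also have "\<dots> \<le> sqrt (s\<^sup>2 + (a - \<sigma>)\<^sup>2)"
    using s0(2) real_sqrt_sum_squares_ge1[of s "a - \<sigma>"] by linarith
  finally show ?thesis .
qed

section \<open>Exterior points from boundary charts\<close>

lemma norm_horiz: "(norm w)\<^sup>2 = (norm (horiz k w))\<^sup>2 + (w $ k)\<^sup>2"
proof -
  have "(norm w)\<^sup>2 = (\<Sum>i\<in>UNIV. (w $ i)\<^sup>2)" for w :: "real^'n"
    by (simp add: norm_vec_def L2_set_def sum_nonneg)
  note n = this
  have "(\<Sum>i\<in>UNIV. (w $ i)\<^sup>2) = (\<Sum>i\<in>UNIV. (horiz k w $ i)\<^sup>2 + (if i = k then (w $ k)\<^sup>2 else 0))"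
    by (intro sum.cong) (auto simp: horiz_def)
  also have "\<dots> = (\<Sum>i\<in>UNIV. (horiz k w $ i)\<^sup>2) + (w $ k)\<^sup>2"
    by (simp add: sum.distrib)
  finally show ?thesis by (simp add: n)
qed

lemma horiz_diff: "horiz k (a - b) = horiz k a - horiz k b"
  by (simp add: horiz_def vec_eq_iff)

lemma horiz_add_axis: "horiz k (a + t *\<^sub>R axis k 1) = horiz k a"
  by (simp add: horiz_def vec_eq_iff axis_def)

text \<open>A ball centred outside \<Omega> that met \<Omega> would contain a boundary point by
  connectedness. It therefore suffices to estimate distances to the boundary, where the chart gives
  an equation.\<close>

lemma exterior_ball_of_boundary_ball:
  fixes p :: "'a::euclidean_space"
  assumes "p \<notin> \<Omega>" "\<And>y. y \<in> frontier \<Omega> \<Longrightarrow> \<rho> \<le> norm (y - p)" "y \<in> \<Omega>"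
  shows "\<rho> \<le> norm (y - p)"
proof (rule ccontr)
  assume less: "\<not> ?thesis"
  then have "y \<in> ball p \<rho> \<inter> \<Omega>" "p \<in> ball p \<rho> - \<Omega>"
    using assms(1,3) le_less_trans[OF norm_ge_zero, of "y - p" \<rho>]
    by (auto simp: dist_norm norm_minus_commute[of p])
  then have "ball p \<rho> \<inter> frontier \<Omega> \<noteq> {}"
    using connected_Int_frontier[OF convex_connected[OF convex_ball]] by blast
  then show False using assms(2) by (force simp: dist_norm norm_minus_commute)
qed

lemma class_C0_exterior_ball:
  fixes \<Omega> :: "(real^'n) set"
  assumes \<omega>: "modulus \<omega>" and cls: "class_C0 \<omega> \<Omega>"
  obtains t1 where "0 < t1"
    "\<And>z t. z \<in> frontier \<Omega> \<Longrightarrow> 0 < t \<Longrightarrow> t < t1 \<Longrightarrow>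
       \<exists>p. dist p z \<le> t \<and> (\<forall>y\<in>\<Omega>. psi \<omega> t \<le> norm (y - p))"
proof -
  obtain r where r: "0 < r" and chart: "\<forall>x0\<in>frontier \<Omega>. \<exists>A p k. \<exists>\<zeta> :: real^'n \<Rightarrow> real.
        orthogonal_matrix A \<and>
        ball x0 r \<inter> \<Omega> = {y \<in> ball x0 r. coord A p y $ k < \<zeta> (horiz k (coord A p y))} \<and>
        ball x0 r \<inter> frontier \<Omega> = {y \<in> ball x0 r. coord A p y $ k = \<zeta> (horiz k (coord A p y))} \<and>
        (\<forall>y \<in> ball x0 r \<inter> frontier \<Omega>. \<forall>z \<in> ball x0 r \<inter> frontier \<Omega>.
           \<bar>\<zeta> (horiz k (coord A p y)) - \<zeta> (horiz k (coord A p z))\<bar>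
             \<le> \<omega> (norm (horiz k (coord A p y) - horiz k (coord A p z))))"
    using cls unfolding class_C0_def by blast
  have "\<exists>p. dist p z \<le> t \<and> (\<forall>y\<in>\<Omega>. psi \<omega> t \<le> norm (y - p))"
    if z: "z \<in> frontier \<Omega>" and t: "0 < t" "t < r / 2" for z t
  proof -
    from chart[rule_format, OF z] obtain A p0 k and \<zeta> :: "real^'n \<Rightarrow> real" where A: "orthogonal_matrix A"
      and int: "ball z r \<inter> \<Omega> = {y \<in> ball z r. coord A p0 y $ k < \<zeta> (horiz k (coord A p0 y))}"
      and bd: "ball z r \<inter> frontier \<Omega> = {y \<in> ball z r. coord A p0 y $ k = \<zeta> (horiz k (coord A p0 y))}"
      and mod: "\<forall>y \<in> ball z r \<inter> frontier \<Omega>. \<forall>z \<in> ball z r \<inter> frontier \<Omega>.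
           \<bar>\<zeta> (horiz k (coord A p0 y)) - \<zeta> (horiz k (coord A p0 z))\<bar>
             \<le> \<omega> (norm (horiz k (coord A p0 y) - horiz k (coord A p0 z)))"
      by blast
    let ?c = "coord A p0"
    have isom: "norm (A *v w) = norm w" for w
      using A orthogonal_transformation_matrix[of "(*v) A"]
      by (simp add: orthogonal_transformation_norm)
    \<comment> \<open>\<open>transpose A\<close> takes the \<open>k\<close>-th axis back to the
      original coordinates; \<Omega> lies below the graph, so this direction points out of
      it.\<close>
    define p where "p = z + t *\<^sub>R (transpose A *v axis k 1)"
    have "A *v (transpose A *v axis k 1) = axis k 1"
      using A by (metis matrix_vector_mul_assoc matrix_vector_mul_lid orthogonal_matrix_def)
    then have Ap: "A *v (p - z) = t *\<^sub>R axis k 1"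
      by (simp only: p_def add_diff_cancel_left' matrix_vector_mult_scaleR)
    have cp: "?c p = ?c z + t *\<^sub>R axis k 1"
      using Ap by (simp add: coord_def matrix_vector_mult_diff_distrib algebra_simps)
    have pz: "norm (p - z) = t"
      using isom[of "p - z"] t by (simp add: Ap)
    have z_bd: "z \<in> ball z r \<inter> frontier \<Omega>" using z r by simp
    then have cz: "?c z $ k = \<zeta> (horiz k (?c z))" using bd by blast
    have "p \<in> ball z r" using pz t by (simp add: dist_norm norm_minus_commute)
    moreover have "\<not> ?c p $ k < \<zeta> (horiz k (?c p))"
      using cz t by (simp add: cp horiz_add_axis)
    ultimately have p: "p \<notin> \<Omega>" using int by blast
    have "psi \<omega> t \<le> norm (y - p)" if y: "y \<in> frontier \<Omega>" for y
    \<comment> \<open>Boundary points at distance at least t are covered by psi \<le> t. The others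
      lie within 2t < r of \<open>z\<close>, hence in the same chart.\<close>
    proof (cases "norm (y - p) < t")
      case False
      then show ?thesis using psi_le_self[OF \<omega> t(1)] by simp
    next
      case True
      have "norm (y - z) \<le> norm (y - p) + norm (p - z)"
        using norm_triangle_ineq[of "y - p" "p - z"] by simp
      then have y_bd: "y \<in> ball z r \<inter> frontier \<Omega>"
        using True pz t y by (simp add: dist_norm norm_minus_commute)
      then have cy: "?c y $ k = \<zeta> (horiz k (?c y))" using bd by blast
      define s where "s = norm (horiz k (?c y) - horiz k (?c z))"
      define a where "a = ?c y $ k - ?c z $ k"
      have "a \<le> \<omega> s"
        using mod[rule_format, OF y_bd z_bd] by (simp add: a_def s_def cy cz)
      have "horiz k (?c y - ?c p) = horiz k (?c y) - horiz k (?c z)" "(?c y - ?c p) $ k = a - t"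
        by (simp_all add: horiz_diff cp horiz_add_axis a_def)
      note components = this
      have "(norm (y - p))\<^sup>2 = (norm (?c y - ?c p))\<^sup>2"
        using isom[of "y - p"] by (simp add: coord_def matrix_vector_mult_diff_distrib)
      also have "\<dots> = s\<^sup>2 + (a - t)\<^sup>2"
        unfolding norm_horiz[of "?c y - ?c p" k] components s_def ..
      finally have "norm (y - p) = sqrt (s\<^sup>2 + (a - t)\<^sup>2)"
        by (rule real_sqrt_unique[symmetric]) simp
      then show ?thesis
        using psi_le_below_graph[OF \<omega> t(1) _ \<open>a \<le> \<omega> s\<close>] by (simp add: s_def)
    qed
    then have "\<forall>y\<in>\<Omega>. psi \<omega> t \<le> norm (y - p)"
      using exterior_ball_of_boundary_ball[OF p] by blast
    then show ?thesis using pz by (intro exI[of _ p]) (simp add: dist_norm)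
  qed
  then show thesis using that[of "r / 2"] r by auto
qed

section \<open>Short-time asymptotics\<close>

lemma log_solution_lower_bound:
  fixes v :: "(real^'n) \<times> real \<Rightarrow> real"
  assumes "is_solution F \<Omega> v" "open \<Omega>" "bounded \<Omega>" and F: "radial_bounds F \<mu> \<Lambda>"
    and "0 < \<rho>" "\<And>y. y \<in> \<Omega> \<Longrightarrow> \<rho> \<le> norm (y - p)" and "x \<in> \<Omega>" and t: "0 < t"
    and k: "k = real CARD('n) * \<Lambda> / (2 * \<mu>)"
  shows "0 < v (x, t)"
    and "4 * t * k * (1 + ln (\<rho>\<^sup>2 / (4 * \<mu> * k)) - ln t) - (norm (x - p))\<^sup>2 / \<mu> \<le> 4 * t * ln (v (x, t))"
proof -
  let ?e = "k * (1 + ln (\<rho>\<^sup>2 / (4 * \<mu> * k)) - ln t) - (norm (x - p))\<^sup>2 / (4 * \<mu> * t)"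
  have \<mu>: "0 < \<mu>" using F by (simp add: radial_bounds_def)
  have "exp ?e \<le> v (x, t)" by (rule solution_lower_bound[OF assms])
  then show pos: "0 < v (x, t)" by (rule less_le_trans[OF exp_gt_zero])
  then have "?e \<le> ln (v (x, t))" using \<open>exp ?e \<le> _\<close> by (simp add: ln_ge_iff)
  then have "4 * t * ?e \<le> 4 * t * ln (v (x, t))" using t by (intro mult_left_mono) auto
  moreover have "4 * t * ?e = 4 * t * k * (1 + ln (\<rho>\<^sup>2 / (4 * \<mu> * k)) - ln t) - (norm (x - p))\<^sup>2 / \<mu>"
    using t \<mu> by (simp add: right_diff_distrib)
  ultimately show "4 * t * k * (1 + ln (\<rho>\<^sup>2 / (4 * \<mu> * k)) - ln t) - (norm (x - p))\<^sup>2 / \<mu> \<le> 4 * t * ln (v (x, t))"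
    by simp
qed

text \<open>A bounded set has an exterior ball of radius 1, and any exterior ball yields a positive
  lower barrier. Positivity is what permits taking logarithms in the upper bound.\<close>

lemma solution_pos:
  fixes v :: "(real^'n) \<times> real \<Rightarrow> real"
  assumes "is_solution F \<Omega> v" "open \<Omega>" "bounded \<Omega>" "radial_bounds F \<mu> \<Lambda>" "x \<in> \<Omega>" "0 < t"
  shows "0 < v (x, t)"
proof -
  obtain b where b: "\<And>y. y \<in> \<Omega> \<Longrightarrow> norm y \<le> b" "0 < b"
    using \<open>bounded \<Omega>\<close> unfolding bounded_pos by auto
  obtain p :: "real^'n" where p: "norm p = b + 1"
    using vector_choose_size[of "b + 1"] b(2) by auto
  have "1 \<le> norm (y - p)" if "y \<in> \<Omega>" for y
    using b(1)[OF that] p norm_triangle_ineq2[of p y] by (simp add: norm_minus_commute)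
  then show ?thesis
    using log_solution_lower_bound(1)[OF assms(1-4) zero_less_one _ assms(5,6) refl] by blast
qed

lemma infdist_frontier_pos:
  fixes \<Omega> :: "'a::euclidean_space set"
  assumes "open \<Omega>" "bounded \<Omega>" "x \<in> \<Omega>"
  shows "frontier \<Omega> \<noteq> {}" "0 < infdist x (frontier \<Omega>)"
proof -
  have "\<Omega> \<noteq> UNIV" using assms(2) not_bounded_UNIV by blast
  then show ne: "frontier \<Omega> \<noteq> {}" using assms(3) frontier_not_empty[of \<Omega>] by blast
  have "x \<notin> frontier \<Omega>" using assms by (simp add: frontier_def interior_open)
  then show "0 < infdist x (frontier \<Omega>)"
    using ne by (intro infdist_pos_not_in_closed) auto
qed

text \<open>For t < 1/e one has -ln t \<ge> 1, so constants are absorbed into multiples of -ln t.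
  The polynomial prefactor contributes ln(1 + K) - ln t per power, uniformly in x because distances
  to the boundary are bounded by \<open>D\<close>.\<close>

lemma log_solution_upper_bound:
  fixes v :: "(real^'n) \<times> real \<Rightarrow> real"
  assumes sol: "is_solution F \<Omega> v" and \<Omega>: "open \<Omega>" "bounded \<Omega>" and F: "radial_bounds F \<mu> \<Lambda>"
  shows "\<exists>C>0. \<forall>x\<in>\<Omega>. \<forall>t. 0 < t \<and> t < exp (- 1) \<longrightarrow>
       4 * t * ln (v (x, t)) + (infdist x (frontier \<Omega>))\<^sup>2 / \<mu> \<le> C * (t * - ln t)"
proof -
  have \<mu>: "0 < \<mu>" using F by (simp add: radial_bounds_def)
  define N where "N = CARD('n)"
  define c where "c = 2 * (1 + real N * fact (2 * N))"
  have c: "1 \<le> c" by (simp add: c_def)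
  obtain D where D: "\<And>y. y \<in> \<Omega> \<Longrightarrow> infdist y (frontier \<Omega>) \<le> D"
  proof (cases "\<Omega> = {}")
    case False
    then obtain a where a: "a \<in> frontier \<Omega>"
      using infdist_frontier_pos(1)[OF \<Omega>] by blast
    have "infdist y (frontier \<Omega>) \<le> diameter (closure \<Omega>)" if "y \<in> \<Omega>" for y
    proof -
      have "dist y a \<le> diameter (closure \<Omega>)"
        using a that \<Omega>(2) closure_subset[of \<Omega>]
        by (intro diameter_bounded_bound) (auto simp: frontier_def)
      with infdist_le[OF a, of y] show ?thesis by simp
    qed
    then show ?thesis using that by blast
  qed (use that in blast)
  define K where "K = D\<^sup>2 / (2 * \<mu>)"
  have K: "0 \<le> K" using \<mu> by (simp add: K_def)
  define C where "C = 4 * (ln c + real (2 * N) * ln (1 + K) + real (2 * N) + 1)"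
  have "0 < C" using c K by (simp add: C_def add_nonneg_pos)
  moreover have "4 * t * ln (v (x, t)) + (infdist x (frontier \<Omega>))\<^sup>2 / \<mu> \<le> C * (t * - ln t)"
    if x: "x \<in> \<Omega>" and t: "0 < t" "t < exp (- 1)" for x t
  proof -
    define d where "d = infdist x (frontier \<Omega>)"
    have d: "0 < d" "d \<le> D" using infdist_frontier_pos(2)[OF \<Omega> x] D[OF x] by (auto simp: d_def)
    define b where "b = 1 + d\<^sup>2 / (2 * \<mu> * t)"
    have b: "0 < b" using t \<mu> by (simp add: b_def add_pos_nonneg)
    have l: "1 \<le> - ln t" using t ln_less_cancel_iff[of t "exp (- 1)"] by simp
    have "exp (- 1) \<le> (1::real)" by simp
    then have t1: "t \<le> 1" using t by linarith
    have "b \<le> (1 + K) / t"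
    proof -
      have "d\<^sup>2 \<le> D\<^sup>2" using d by (intro power_mono) auto
      then have "d\<^sup>2 / (2 * \<mu> * t) \<le> K / t"
        using t \<mu> by (simp add: K_def divide_right_mono)
      moreover have "1 \<le> 1 / t" using t t1 by simp
      ultimately show ?thesis by (simp add: b_def add_divide_distrib)
    qed
    then have "ln b \<le> ln ((1 + K) / t)" using b by simp
    also have "\<dots> = ln (1 + K) - ln t" using K t by (simp add: ln_div)
    finally have lnb: "ln b \<le> ln (1 + K) - ln t" .
    have "v (x, t) \<le> c * b ^ (2 * N) * exp (- d\<^sup>2 / (4 * \<mu> * t))"
      using solution_upper_bound[OF sol \<Omega>(1) F x t(1) d_def d(1) N_def] by (simp add: c_def b_def)
    then have "ln (v (x, t)) \<le> ln (c * b ^ (2 * N) * exp (- d\<^sup>2 / (4 * \<mu> * t)))"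
      using solution_pos[OF sol \<Omega> F x t(1)] by simp
    also have "\<dots> = ln c + real (2 * N) * ln b - d\<^sup>2 / (4 * \<mu> * t)"
      using b c by (simp add: ln_mult ln_realpow)
    also have "\<dots> \<le> ln c + real (2 * N) * (ln (1 + K) - ln t) - d\<^sup>2 / (4 * \<mu> * t)"
      using lnb by (intro diff_right_mono add_left_mono mult_left_mono) auto
    finally have "4 * t * ln (v (x, t)) \<le> 4 * t * (ln c + real (2 * N) * (ln (1 + K) - ln t) - d\<^sup>2 / (4 * \<mu> * t))"
      using t by (intro mult_left_mono) auto
    also have "\<dots> = 4 * t * (ln c + real (2 * N) * (ln (1 + K) - ln t)) - d\<^sup>2 / \<mu>"
      using t \<mu> by (simp add: right_diff_distrib)
    finally have "4 * t * ln (v (x, t)) + d\<^sup>2 / \<mu> \<le> 4 * t * (ln c + real (2 * N) * (ln (1 + K) - ln t))"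
      by simp
    also have "\<dots> \<le> 4 * t * ((ln c + real (2 * N) * ln (1 + K) + real (2 * N) + 1) * - ln t)"
    proof (rule mult_left_mono)
      have "(ln c + real (2 * N) * ln (1 + K)) * 1 \<le> (ln c + real (2 * N) * ln (1 + K)) * - ln t"
        using l c K by (intro mult_left_mono) auto
      then show "ln c + real (2 * N) * (ln (1 + K) - ln t)
          \<le> (ln c + real (2 * N) * ln (1 + K) + real (2 * N) + 1) * - ln t"
        using l by (simp add: algebra_simps)
    qed (use t in simp)
    finally show ?thesis by (simp add: C_def d_def mult_ac)
  qed
  ultimately show ?thesis by blast
qed

lemma solution_boundary:
  assumes "is_solution F \<Omega> v" "x \<in> frontier \<Omega>" "0 < t"
  shows "v (x, t) = 1" "infdist x (frontier \<Omega>) = 0"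
  using assms unfolding is_solution_def by (blast, simp add: infdist_zero)

lemma log_solution_tendsto:
  fixes v :: "(real^'n) \<times> real \<Rightarrow> real"
  assumes sol: "is_solution F \<Omega> v" and \<Omega>: "open \<Omega>" "bounded \<Omega>" and F: "radial_bounds F \<mu> \<Lambda>"
    and ext: "frontier \<Omega> = frontier (- closure \<Omega>)" and x: "x \<in> closure \<Omega>"
  shows "((\<lambda>t. 4 * t * ln (v (x, t))) \<longlongrightarrow> - ((infdist x (frontier \<Omega>))\<^sup>2 / \<mu>)) (at_right 0)"
proof -
  consider "x \<in> \<Omega>" | "x \<in> frontier \<Omega>" using x closure_Un_frontier by blast
  then show ?thesis
  proof cases
    case 2
    have "eventually (\<lambda>t. 4 * t * ln (v (x, t)) = 0) (at_right 0)"
      using eventually_at_right_less[of "0::real"] by eventually_elim (simp add: solution_boundary(1)[OF sol 2])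
    then show ?thesis
      using solution_boundary(2)[OF sol 2 zero_less_one] by (simp add: tendsto_eventually)
  next
    case 1
    define d where "d = infdist x (frontier \<Omega>)"
    have \<mu>: "0 < \<mu>" using F by (simp add: radial_bounds_def)
    show ?thesis unfolding d_def[symmetric]
    proof (rule order_tendstoI)
      \<comment> \<open>Choose \<delta> so small that an exterior point within \<delta> of the
        nearest boundary point still gives a limit above \<open>a\<close>.\<close>
      fix a assume "a < - (d\<^sup>2 / \<mu>)"
      moreover have "((\<lambda>\<delta>. - ((d + \<delta>)\<^sup>2 / \<mu>)) \<longlongrightarrow> - ((d + 0)\<^sup>2 / \<mu>)) (at_right 0)"
        using \<mu> by (intro tendsto_intros) auto
      ultimately have "eventually (\<lambda>\<delta>. a < - ((d + \<delta>)\<^sup>2 / \<mu>)) (at_right 0)"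
        by (intro order_tendstoD(1)) auto
      then obtain b where "0 < b" and b: "\<And>\<delta>. 0 < \<delta> \<Longrightarrow> \<delta> < b \<Longrightarrow> a < - ((d + \<delta>)\<^sup>2 / \<mu>)"
        unfolding eventually_at_right_field by auto
      define \<delta> where "\<delta> = b / 2"
      have \<delta>: "0 < \<delta>" "a < - ((d + \<delta>)\<^sup>2 / \<mu>)" using \<open>0 < b\<close> b[of \<delta>] by (auto simp: \<delta>_def)
      obtain z where z: "z \<in> frontier \<Omega>" "d = dist x z"
        unfolding d_def using infdist_attains_inf[OF frontier_closed infdist_frontier_pos(1)[OF \<Omega> 1]] by blast
      \<comment> \<open>The hypothesis of (i) enters here: exterior points accumulate at
        \<open>z\<close>. The point \<open>p\<close> and radius \<open>\<rho>\<close> are then fixed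
        as t tends to 0, so the remaining terms of order t ln t vanish.\<close>
      then have "z \<in> frontier (- closure \<Omega>)" using ext by metis
      then have "z \<in> closure (- closure \<Omega>)" by (simp add: frontier_def)
      then obtain p where p: "p \<in> - closure \<Omega>" "dist p z < \<delta>"
        using \<delta>(1) by (auto simp: closure_approachable)
      obtain \<rho> where \<rho>: "0 < \<rho>" "ball p \<rho> \<subseteq> - closure \<Omega>"
        using openE[of "- closure \<Omega>" p] p(1) by auto
      have far: "\<rho> \<le> norm (y - p)" if "y \<in> \<Omega>" for y
      proof (rule ccontr)
        assume "\<not> ?thesis"
        then have "y \<in> ball p \<rho>" by (simp add: dist_norm norm_minus_commute)
        with \<rho>(2) that closure_subset[of \<Omega>] show False by blast
      qed
      define k where "k = real CARD('n) * \<Lambda> / (2 * \<mu>)"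
      define c where "c = 1 + ln (\<rho>\<^sup>2 / (4 * \<mu> * k))"
      have "norm (x - p) \<le> d + \<delta>"
        using dist_triangle[of x p z] p(2) z(2) by (simp add: dist_norm norm_minus_commute)
      then have "(norm (x - p))\<^sup>2 \<le> (d + \<delta>)\<^sup>2" by (intro power_mono) auto
      then have "(norm (x - p))\<^sup>2 / \<mu> \<le> (d + \<delta>)\<^sup>2 / \<mu>" using \<mu> by (simp add: divide_right_mono)
      then have "a < - ((norm (x - p))\<^sup>2 / \<mu>)" using \<delta>(2) by simp
      moreover have "((\<lambda>t. 4 * t * k * (c - ln t) - e) \<longlongrightarrow> - e) (at_right 0)" for e
        by real_asymp
      ultimately have "eventually (\<lambda>t. a < 4 * t * k * (c - ln t) - (norm (x - p))\<^sup>2 / \<mu>) (at_right 0)"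
        by (intro order_tendstoD(1))
      then show "eventually (\<lambda>t. a < 4 * t * ln (v (x, t))) (at_right 0)"
        using eventually_at_right_less[of "0::real"]
      proof eventually_elim
        case (elim t)
        from log_solution_lower_bound(2)[OF sol \<Omega> F \<rho>(1) far 1 elim(2) k_def] elim(1)
        show ?case by (simp add: c_def)
      qed
    next
      fix a assume a: "- (d\<^sup>2 / \<mu>) < a"
      obtain C where "\<forall>x\<in>\<Omega>. \<forall>t. 0 < t \<and> t < exp (- 1) \<longrightarrow>
          4 * t * ln (v (x, t)) + (infdist x (frontier \<Omega>))\<^sup>2 / \<mu> \<le> C * (t * - ln t)"
        using log_solution_upper_bound[OF sol \<Omega> F] by blast
      from this[rule_format, OF 1] have C: "4 * t * ln (v (x, t)) + d\<^sup>2 / \<mu> \<le> C * (t * - ln t)"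
        if "0 < t" "t < exp (- 1)" for t
        using that by (simp add: d_def)
      have "((\<lambda>t. C * (t * - ln t) - e) \<longlongrightarrow> - e) (at_right 0)" for e
        by real_asymp
      from order_tendstoD(2)[OF this a]
      have "eventually (\<lambda>t. C * (t * - ln t) - d\<^sup>2 / \<mu> < a) (at_right 0)" .
      moreover have "eventually (\<lambda>t::real. t \<in> {0<..<exp (- 1)}) (at_right 0)"
        by (intro eventually_at_right_real) simp
      ultimately show "eventually (\<lambda>t. 4 * t * ln (v (x, t)) < a) (at_right 0)"
      proof eventually_elim
        case (elim t)
        with C[of t] show ?case by simp
      qed
    qed
  qed
qed

text \<open>Now the exterior ball varies with t: its centre is within t of the nearest boundary
  point and its radius is psi(t). The radius costs a multiple of t |ln psi(t)|, and the displacement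
  costs (d + t)^2 - d^2 = O(t). Since psi(t) \<le> t < 1/e, the quantity l = -ln psi(t) dominates
  both -ln t and 1.\<close>

lemma log_solution_bigo:
  fixes v :: "(real^'n) \<times> real \<Rightarrow> real"
  assumes sol: "is_solution F \<Omega> v" and \<Omega>: "open \<Omega>" "bounded \<Omega>" and F: "radial_bounds F \<mu> \<Lambda>"
    and \<omega>: "modulus \<omega>" "class_C0 \<omega> \<Omega>" and K: "K \<subseteq> closure \<Omega>"
  shows "uniform_bigo K (\<lambda>x t. 4 * t * ln (v (x, t)) + (infdist x (frontier \<Omega>))\<^sup>2 / \<mu>)
    (\<lambda>t. t * ln (psi \<omega> t))"
proof -
  have \<mu>: "0 < \<mu>" and \<Lambda>: "0 < \<Lambda>" using F by (auto simp: radial_bounds_def)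
  obtain C where C: "0 < C" "\<forall>x\<in>\<Omega>. \<forall>t. 0 < t \<and> t < exp (- 1) \<longrightarrow>
       4 * t * ln (v (x, t)) + (infdist x (frontier \<Omega>))\<^sup>2 / \<mu> \<le> C * (t * - ln t)"
    using log_solution_upper_bound[OF sol \<Omega> F] by blast
  obtain t1 where t1: "0 < t1"
    "\<And>z t. z \<in> frontier \<Omega> \<Longrightarrow> 0 < t \<Longrightarrow> t < t1 \<Longrightarrow>
       \<exists>p. dist p z \<le> t \<and> (\<forall>y\<in>\<Omega>. psi \<omega> t \<le> norm (y - p))"
    using class_C0_exterior_ball[OF \<omega>] by blast
  obtain D where D: "0 < D" "\<And>y z. y \<in> closure \<Omega> \<Longrightarrow> z \<in> closure \<Omega> \<Longrightarrow> dist y z \<le> D"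
  proof
    have bdd: "bounded (closure \<Omega>)" using \<Omega>(2) by (rule bounded_closure)
    from diameter_ge_0[OF this] show "0 < diameter (closure \<Omega>) + 1" by linarith
    show "dist y z \<le> diameter (closure \<Omega>) + 1" if "y \<in> closure \<Omega>" "z \<in> closure \<Omega>" for y z
      using diameter_bounded_bound[OF bdd that] by linarith
  qed
  define k where "k = real CARD('n) * \<Lambda> / (2 * \<mu>)"
  have k: "0 < k" using \<mu> \<Lambda> by (simp add: k_def)
  define c where "c = \<bar>1 - ln (4 * \<mu> * k)\<bar>"
  \<comment> \<open>The first summand pays for the logarithm of the barrier constant, the second for
    the displacement 2dt + t^2 with d \<le> D and t \<le> 1.\<close>
  define C' where "C' = 4 * k * (c + 2) + (2 * D + 1) / \<mu>"
  have "\<bar>4 * t * ln (v (x, t)) + (infdist x (frontier \<Omega>))\<^sup>2 / \<mu>\<bar> \<le> max C C' * \<bar>t * ln (psi \<omega> t)\<bar>"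
    if "x \<in> K" and t: "0 < t" "t < min t1 (exp (- 1))" for x t
  proof -
    consider "x \<in> \<Omega>" | "x \<in> frontier \<Omega>" using K \<open>x \<in> K\<close> closure_Un_frontier by blast
    then show ?thesis
    proof cases
      case 2
      then have "4 * t * ln (v (x, t)) + (infdist x (frontier \<Omega>))\<^sup>2 / \<mu> = 0"
        by (simp add: solution_boundary[OF sol _ t(1)])
      moreover have "0 \<le> max C C' * \<bar>t * ln (psi \<omega> t)\<bar>"
        using C(1) by (intro mult_nonneg_nonneg) auto
      ultimately show ?thesis by simp
    next
      case 1
      define d where "d = infdist x (frontier \<Omega>)"
      define l where "l = - ln (psi \<omega> t)"
      have psi: "0 < psi \<omega> t" "psi \<omega> t \<le> t"
        using psi_pos[OF \<omega>(1) t(1)] psi_le_self[OF \<omega>(1) t(1)] .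
      have lt: "1 \<le> - ln t" using t ln_less_cancel_iff[of t "exp (- 1)"] by simp
      have "ln (psi \<omega> t) \<le> ln t" using psi t by simp
      then have l: "- ln t \<le> l" "1 \<le> l" using lt by (auto simp: l_def)
      have "exp (- 1) \<le> (1::real)" by simp
      then have t_le1: "t \<le> 1" using t by linarith
      have abs: "\<bar>t * ln (psi \<omega> t)\<bar> = t * l" using l t by (simp add: l_def abs_mult)
      have "4 * t * ln (v (x, t)) + d\<^sup>2 / \<mu> \<le> C * (t * - ln t)"
        using C(2)[rule_format, OF 1] t by (simp add: d_def)
      also have "\<dots> \<le> C * (t * l)"
        using C(1) l t by (intro mult_left_mono) auto
      also have "\<dots> \<le> max C C' * (t * l)"
        using l t by (intro mult_right_mono mult_nonneg_nonneg) auto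
      finally have upper: "4 * t * ln (v (x, t)) + d\<^sup>2 / \<mu> \<le> max C C' * (t * l)" .
      obtain z where z: "z \<in> frontier \<Omega>" "d = dist x z"
        unfolding d_def using infdist_attains_inf[OF frontier_closed infdist_frontier_pos(1)[OF \<Omega> 1]] by blast
      obtain p where p: "dist p z \<le> t" "\<forall>y\<in>\<Omega>. psi \<omega> t \<le> norm (y - p)"
        using t1(2)[OF z(1) t(1)] t by auto
      have d: "0 \<le> d" "d \<le> D" using D(2)[of x z] z 1 closure_subset[of \<Omega>] by (auto simp: frontier_def)
      have "norm (x - p) \<le> d + t"
        using dist_triangle[of x p z] p(1) z(2) by (simp add: dist_norm norm_minus_commute)
      then have "(norm (x - p))\<^sup>2 \<le> (d + t)\<^sup>2" by (intro power_mono) auto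
      also have "\<dots> = d\<^sup>2 + t * (2 * d + t)" by (simp add: power2_eq_square algebra_simps)
      also have "\<dots> \<le> d\<^sup>2 + t * (2 * D + 1)" using d t t_le1 by (intro add_left_mono mult_left_mono) auto
      also have "\<dots> \<le> d\<^sup>2 + t * (2 * D + 1) * l"
        using l D(1) t mult_left_mono[of 1 l "t * (2 * D + 1)"] by simp
      finally have "(norm (x - p))\<^sup>2 / \<mu> \<le> (d\<^sup>2 + t * (2 * D + 1) * l) / \<mu>"
        using \<mu> by (simp add: divide_right_mono)
      then have dist: "(norm (x - p))\<^sup>2 / \<mu> \<le> d\<^sup>2 / \<mu> + (2 * D + 1) / \<mu> * (t * l)"
        by (simp add: add_divide_distrib algebra_simps)
      have "1 + ln ((psi \<omega> t)\<^sup>2 / (4 * \<mu> * k)) - ln t = 1 - ln (4 * \<mu> * k) - 2 * l - ln t"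
        using psi \<mu> k by (simp add: ln_div ln_realpow l_def)
      \<comment> \<open>The constant is at least -c \<ge> -c l, the squared radius contributes -2 l,
        and -ln t is positive.\<close>
      also have "\<dots> \<ge> - ((c + 2) * l)"
      proof -
        have "c \<le> c * l" using l mult_left_mono[of 1 l c] by (simp add: c_def)
        moreover have "- c \<le> 1 - ln (4 * \<mu> * k)" by (simp add: c_def)
        ultimately show ?thesis using lt by (simp add: distrib_right)
      qed
      finally have "4 * t * k * - ((c + 2) * l) \<le> 4 * t * k * (1 + ln ((psi \<omega> t)\<^sup>2 / (4 * \<mu> * k)) - ln t)"
        using t k by (intro mult_left_mono) auto
      moreover have "4 * t * k * (1 + ln ((psi \<omega> t)\<^sup>2 / (4 * \<mu> * k)) - ln t) - (norm (x - p))\<^sup>2 / \<mu>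
          \<le> 4 * t * ln (v (x, t))"
        by (rule log_solution_lower_bound(2)[OF sol \<Omega> F psi(1) _ 1 t(1) k_def]) (use p(2) in blast)
      moreover have "C' * (t * l) = 4 * t * k * ((c + 2) * l) + (2 * D + 1) / \<mu> * (t * l)"
        by (simp add: C'_def algebra_simps)
      ultimately have "- (C' * (t * l)) \<le> 4 * t * ln (v (x, t)) + d\<^sup>2 / \<mu>"
        using dist unfolding mult_minus_right by linarith
      moreover have "C' * (t * l) \<le> max C C' * (t * l)"
        using l t by (intro mult_right_mono mult_nonneg_nonneg) auto
      ultimately show ?thesis
        using upper unfolding abs d_def[symmetric] by (simp add: abs_le_iff)
    qed
  qed
  then show ?thesis
    unfolding uniform_bigo_def using C(1) t1(1)
    by (intro exI[of _ "max C C'"] conjI exI[of _ "min t1 (exp (- 1))"]) (auto simp: less_max_iff_disj)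
qed

theorem theorem1p2:
  fixes \<Omega> :: "(real^'n) set"
    and lam \<Lambda> :: real
    and vm vp :: "(real^'n) \<times> real \<Rightarrow> real"
  assumes "CARD('n) \<ge> 2"
    and "0 < lam" and "lam \<le> \<Lambda>"
    and "open \<Omega>" and "bounded \<Omega>"
    and "is_solution (pucci_minus lam \<Lambda>) \<Omega> vm"
    and "is_solution (pucci_plus lam \<Lambda>) \<Omega> vp"
  shows
    "(frontier \<Omega> = frontier (- closure \<Omega>) \<longrightarrow>
       (\<forall>x \<in> closure \<Omega>.
          ((\<lambda>t. 4 * t * ln (vm (x, t))) \<longlongrightarrow> - ((infdist x (frontier \<Omega>))\<^sup>2 / lam)) (at_right 0) \<and>
          ((\<lambda>t. 4 * t * ln (vp (x, t))) \<longlongrightarrow> - ((infdist x (frontier \<Omega>))\<^sup>2 / \<Lambda>)) (at_right 0)))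
     \<and>
     (\<forall>\<omega>. modulus \<omega> \<and> class_C0 \<omega> \<Omega> \<longrightarrow>
       (\<forall>K. compact K \<and> K \<subseteq> closure \<Omega> \<longrightarrow>
          uniform_bigo K
            (\<lambda>x t. 4 * t * ln (vm (x, t)) + (infdist x (frontier \<Omega>))\<^sup>2 / lam)
            (\<lambda>t. t * ln (psi \<omega> t)) \<and>
          uniform_bigo K
            (\<lambda>x t. 4 * t * ln (vp (x, t)) + (infdist x (frontier \<Omega>))\<^sup>2 / \<Lambda>)
            (\<lambda>t. t * ln (psi \<omega> t))))"
proof -
  note minus = radial_bounds_pucci(1)[OF assms(2,3)] and plus = radial_bounds_pucci(2)[OF assms(2,3)]
  show ?thesis
    using log_solution_tendsto[OF assms(6,4,5) minus] log_solution_tendsto[OF assms(7,4,5) plus]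
      log_solution_bigo[OF assms(6,4,5) minus] log_solution_bigo[OF assms(7,4,5) plus]
    by (intro conjI impI allI ballI) simp_all
qed

end
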